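(* Let $G:X\to X^{\odot\star}$ be an admissible perturbation for $\{T_0(t)\}_{t\ge0}$ of class $C^k$ for some $k\ge1$, let $\Sigma$ be the associated semiflow on $X$, let $\hat\phi\in X$ be an equilibrium of $\Sigma$, and let $\{T(t)\}_{t\ge0}$ be the $\mathcal{C}_0$-semigroup obtained from $\{T_0(t)\}_{t\ge0}$ by perturbation with $L:=DG(\hat\phi)$. Then $\Sigma$ is partially differentiable with respect to the state at $\hat\phi$, uniformly on compact time intervals, with partial derivative $D_2\Sigma(t,\hat\phi)=T(t)$. Explicitly, for every $t_0\ge0$ and every $\varepsilon>0$ there exists $\delta>0$ such that for all $\phi\in X$ with $\|\phi-\hat\phi\|\le\delta$ and all $t\in[0,t_0]$, $\Sigma(t,\phi)$ is defined and $$\|\Sigma(t,\phi)-\hat\phi-T(t)(\phi-\hat\phi)\|\le\varepsilon\|\phi-\hat\phi\|.$$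
   Context: All vector spaces are real. For a Banach space $E$, $\langle x,x^\star\rangle:=x^\star(x)$. Let $\{T_0(t)\}_{t\ge 0}$ be a $\mathcal{C}_0$-semigroup on a Banach space $X$. $X^\odot:=\{x^\star\in X^\star: \lim_{t\downarrow 0}\|T_0(t)^\star x^\star-x^\star\|=0\}$ (closed subspace), $T_0^\odot(t):=T_0(t)^\star|_{X^\odot}$, $X^{\odot\star}:=(X^\odot)^\star$, $T_0^{\odot\star}(t):=(T_0^\odot(t))^\star$; $j:X\to X^{\odot\star}$, $\langle x^\odot,jx\rangle:=\langle x,x^\odot\rangle$, is injective with closed range $jX$, and $j^{-1}:jX\to X$. Sun-reflexivity is not assumed. Integrals of $X^{\odot\star}$-valued functions are weak$^\star$ integrals: $\langle x^\odot,\int q\,d\tau\rangle:=\int\langle x^\odot,q\rangle d\tau$. A closed subspace $\mathscr{X}_0\subseteq X^{\odot\star}$ is an admissible range for $\{T_0(t)\}$ if for some (equivalently, every) non-degenerate interval $J$, every norm-continuous $f:J\to\mathscr{X}_0$ and all $s\le t$ in $J$ one has $\int_s^tT_0^{\odot\star}(t-\tau)f(\tau)d\tau\in jX$. A continuous $G:X\to X^{\odot\star}$ is an admissible perturbation for $\{T_0(t)\}$ if it takes values in some admissible range for $\{T_0(t)\}$. Semiflow: for every $\phi\in X$ the equation $u(t)=T_0(t)\phi+j^{-1}\int_0^tT_0^{\odot\star}(t-\tau)G(u(\tau))\,d\tau$ has a unique maximal (continuous) solution $u_\phi$ on a maximal interval $J_\phi=[0,t_\phi)$, $0<t_\phi\le\infty$;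 $\Sigma(t,\phi):=u_\phi(t)$ for $t\in J_\phi$. An equilibrium is a point $\hat\phi\in X$ with $J_{\hat\phi}=[0,\infty)$ and $\Sigma(t,\hat\phi)=\hat\phi$ for all $t\ge0$. The perturbed semigroup $\{T(t)\}_{t\ge0}$ is the unique $\mathcal{C}_0$-semigroup on $X$ with $T(t)x=T_0(t)x+j^{-1}\int_0^tT_0^{\odot\star}(t-\tau)LT(\tau)x\,d\tau$ for all $x\in X$, $t\ge0$. *)

theory Defs
  imports "HOL-Analysis.Analysis"
begin

definition C0_semigroup :: "(real \<Rightarrow> 'a::banach \<Rightarrow>\<^sub>L 'a) \<Rightarrow> bool" where
  "C0_semigroup S \<longleftrightarrow>
     S 0 = id_blinfun \<and>
     (\<forall>s\<ge>0. \<forall>t\<ge>0. S (s + t) = S s o\<^sub>L S t) \<and>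
     (\<forall>x. ((\<lambda>t. S t x) \<longlongrightarrow> x) (at_right 0))"


section \<open>The sun dual and its dual\<close>

text \<open>The adjoint of \<open>S t\<close> maps \<open>x'\<close> to \<open>x' o\<^sub>L S t\<close>.\<close>

definition sun :: "(real \<Rightarrow> 'a::banach \<Rightarrow>\<^sub>L 'a) \<Rightarrow> ('a \<Rightarrow>\<^sub>L real) set" where
  "sun S = {x'. ((\<lambda>t. norm ((x' o\<^sub>L S t) - x')) \<longlongrightarrow> 0) (at_right 0)}"

text \<open>
  The sun dual depends on the semigroup and is not a type, so a bounded linear functional on it is
  represented by the function on the whole dual that extends it by \<open>0\<close>. With this convention
  equality of functions is equality of functionals, and the vector space operations are pointwise.
  The pairing of \<open>x'\<close> with the functional \<open>l\<close> is \<open>l x'\<close>.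
\<close>

type_synonym 'a dual_fun = "('a \<Rightarrow>\<^sub>L real) \<Rightarrow> real"

definition sun_star :: "(real \<Rightarrow> 'a::banach \<Rightarrow>\<^sub>L 'a) \<Rightarrow> 'a dual_fun set" where
  "sun_star S = {l.
     (\<forall>x'. x' \<notin> sun S \<longrightarrow> l x' = 0) \<and>
     (\<forall>x'\<in>sun S. \<forall>y'\<in>sun S. l (x' + y') = l x' + l y') \<and>
     (\<forall>c. \<forall>x'\<in>sun S. l (c *\<^sub>R x') = c * l x') \<and>
     (\<exists>C. \<forall>x'\<in>sun S. \<bar>l x'\<bar> \<le> C * norm x')}"

definition sun_star_norm :: "(real \<Rightarrow> 'a::banach \<Rightarrow>\<^sub>L 'a) \<Rightarrow> 'a dual_fun \<Rightarrow> real" where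
  "sun_star_norm S l = (SUP x'\<in>{x' \<in> sun S. norm x' \<le> 1}. \<bar>l x'\<bar>)"

text \<open>
  The value \<open>0\<close> outside the carrier is a dummy: \<^locale>\<open>Metric_space\<close> requires
  the distance to be nonnegative everywhere.
\<close>

definition sun_star_dist ::
    "(real \<Rightarrow> 'a::banach \<Rightarrow>\<^sub>L 'a) \<Rightarrow> 'a dual_fun \<Rightarrow> 'a dual_fun \<Rightarrow> real" where
  "sun_star_dist S l m =
     (if l \<in> sun_star S \<and> m \<in> sun_star S then sun_star_norm S (\<lambda>x'. l x' - m x') else 0)"

definition sun_star_topology :: "(real \<Rightarrow> 'a::banach \<Rightarrow>\<^sub>L 'a) \<Rightarrow> 'a dual_fun topology" where
  "sun_star_topology S = Metric_space.mtopology (sun_star S) (sun_star_dist S)"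

definition sun_star_semigroup ::
    "(real \<Rightarrow> 'a::banach \<Rightarrow>\<^sub>L 'a) \<Rightarrow> real \<Rightarrow> 'a dual_fun \<Rightarrow> 'a dual_fun" where
  "sun_star_semigroup S t l = (\<lambda>x'. if x' \<in> sun S then l (x' o\<^sub>L S t) else 0)"

definition sun_embed :: "(real \<Rightarrow> 'a::banach \<Rightarrow>\<^sub>L 'a) \<Rightarrow> 'a \<Rightarrow> 'a dual_fun" where
  "sun_embed S x = (\<lambda>x'. if x' \<in> sun S then blinfun_apply x' x else 0)"

definition weak_star_integral :: "real \<Rightarrow> real \<Rightarrow> (real \<Rightarrow> 'a::banach dual_fun) \<Rightarrow> 'a dual_fun" where
  "weak_star_integral s t q = (\<lambda>x'. integral {s..t} (\<lambda>\<tau>. q \<tau> x'))"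

lemma sun_0: "0 \<in> sun S"
  by (simp add: sun_def)

lemma sun_scaleR: "x' \<in> sun S \<Longrightarrow> c *\<^sub>R x' \<in> sun S"
proof -
  assume x: "x' \<in> sun S"
  have "norm (((c *\<^sub>R x') o\<^sub>L S t) - c *\<^sub>R x') = \<bar>c\<bar> * norm ((x' o\<^sub>L S t) - x')" for t
  proof -
    have "((c *\<^sub>R x') o\<^sub>L S t) - c *\<^sub>R x' = c *\<^sub>R ((x' o\<^sub>L S t) - x')"
      by (rule blinfun_eqI) (simp add: blinfun.bilinear_simps algebra_simps)
    then show ?thesis by simp
  qed
  then show "c *\<^sub>R x' \<in> sun S"
    using x by (auto simp: sun_def intro!: tendsto_mult_right_zero)
qed

lemma sun_star_diff: "l \<in> sun_star S \<Longrightarrow> m \<in> sun_star S \<Longrightarrow> (\<lambda>x'. l x' - m x') \<in> sun_star S"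
proof -
  assume l: "l \<in> sun_star S" and m: "m \<in> sun_star S"
  obtain C where C: "\<And>x'. x' \<in> sun S \<Longrightarrow> \<bar>l x'\<bar> \<le> C * norm x'"
    using l unfolding sun_star_def by blast
  obtain D where D: "\<And>x'. x' \<in> sun S \<Longrightarrow> \<bar>m x'\<bar> \<le> D * norm x'"
    using m unfolding sun_star_def by blast
  have "\<bar>l x' - m x'\<bar> \<le> (C + D) * norm x'" if "x' \<in> sun S" for x'
    using C[OF that] D[OF that] by (simp add: algebra_simps)
  then have "\<exists>K. \<forall>x'\<in>sun S. \<bar>l x' - m x'\<bar> \<le> K * norm x'" by blast
  then show ?thesis using l m by (simp add: sun_star_def algebra_simps)
qed

lemma sun_star_norm_bdd:
  assumes "l \<in> sun_star S"
  shows "bdd_above ((\<lambda>x'. \<bar>l x'\<bar>) ` {x' \<in> sun S. norm x' \<le> 1})"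
proof -
  obtain C where C: "\<And>x'. x' \<in> sun S \<Longrightarrow> \<bar>l x'\<bar> \<le> C * norm x'"
    using assms unfolding sun_star_def by blast
  have "\<bar>l x'\<bar> \<le> \<bar>C\<bar>" if "x' \<in> sun S" "norm x' \<le> 1" for x'
  proof -
    have "C * norm x' \<le> \<bar>C\<bar> * 1"
      using that by (intro mult_mono) auto
    with C[OF that(1)] show ?thesis by simp
  qed
  then show ?thesis by (auto intro!: bdd_aboveI[where M = "\<bar>C\<bar>"])
qed

lemma sun_star_norm_upper:
  assumes "l \<in> sun_star S" "x' \<in> sun S" "norm x' \<le> 1"
  shows "\<bar>l x'\<bar> \<le> sun_star_norm S l"
  unfolding sun_star_norm_def using assms by (intro cSUP_upper sun_star_norm_bdd) auto

lemma sun_star_norm_nonneg: "l \<in> sun_star S \<Longrightarrow> 0 \<le> sun_star_norm S l"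
  using sun_star_norm_upper[OF _ sun_0, of l S] by auto

lemma sun_star_norm_leI:
  assumes "\<And>x'. x' \<in> sun S \<Longrightarrow> norm x' \<le> 1 \<Longrightarrow> \<bar>l x'\<bar> \<le> K"
  shows "sun_star_norm S l \<le> K"
  unfolding sun_star_norm_def using assms sun_0[of S] by (intro cSUP_least) force+

lemma Metric_space_sun_star: "Metric_space (sun_star S) (sun_star_dist S)"
proof
  show "0 \<le> sun_star_dist S l m" for l m
    by (simp add: sun_star_dist_def sun_star_norm_nonneg sun_star_diff)
  show "sun_star_dist S l m = sun_star_dist S m l" for l m
    by (simp add: sun_star_dist_def sun_star_norm_def abs_minus_commute)
next
  fix l m assume l: "l \<in> sun_star S" and m: "m \<in> sun_star S"
  let ?d = "\<lambda>x'. l x' - m x'"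
  have d: "?d \<in> sun_star S" using l m by (rule sun_star_diff)
  show "sun_star_dist S l m = 0 \<longleftrightarrow> l = m"
  proof
    assume "sun_star_dist S l m = 0"
    then have n: "sun_star_norm S ?d = 0" using l m by (simp add: sun_star_dist_def)
    have "l x' = m x'" for x'
    proof (cases "x' \<in> sun S \<and> x' \<noteq> 0")
      case True
      let ?y = "(1 / norm x') *\<^sub>R x'"
      have "\<bar>?d ?y\<bar> \<le> 0"
        using sun_star_norm_upper[OF d sun_scaleR, of x' "1 / norm x'"] True n by simp
      moreover have "?d ?y = (1 / norm x') * ?d x'"
        using d True unfolding sun_star_def by blast
      ultimately show ?thesis using True by (simp add: divide_le_0_iff)
    next
      case False
      then consider "x' \<notin> sun S" | "x' = 0" by blast
      then show ?thesis
      proof cases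
        case 1
        then show ?thesis using l m by (simp add: sun_star_def)
      next
        case 2
        have "k 0 = 0" if "k \<in> sun_star S" for k
        proof -
          have "k (0 *\<^sub>R 0) = 0 * k 0" using that sun_0[of S] unfolding sun_star_def by blast
          then show ?thesis by simp
        qed
        from this[OF l] this[OF m] 2 show ?thesis by simp
      qed
    qed
    then show "l = m" by blast
  next
    assume "l = m"
    then have "sun_star_norm S ?d \<le> 0" by (intro sun_star_norm_leI) simp
    with sun_star_norm_nonneg[OF d] l m show "sun_star_dist S l m = 0"
      by (simp add: sun_star_dist_def)
  qed
next
  fix l m k assume l: "l \<in> sun_star S" and m: "m \<in> sun_star S" and k: "k \<in> sun_star S"
  have "sun_star_norm S (\<lambda>x'. l x' - k x')
      \<le> sun_star_norm S (\<lambda>x'. l x' - m x') + sun_star_norm S (\<lambda>x'. m x' - k x')"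
  proof (rule sun_star_norm_leI)
    fix x' assume x: "x' \<in> sun S" "norm x' \<le> 1"
    show "\<bar>l x' - k x'\<bar>
        \<le> sun_star_norm S (\<lambda>x'. l x' - m x') + sun_star_norm S (\<lambda>x'. m x' - k x')"
      using sun_star_norm_upper[OF sun_star_diff[OF l m] x]
        sun_star_norm_upper[OF sun_star_diff[OF m k] x] by linarith
  qed
  then show "sun_star_dist S l k \<le> sun_star_dist S l m + sun_star_dist S m k"
    using l m k by (simp add: sun_star_dist_def)
qed


section \<open>Admissible ranges and perturbations\<close>

definition closed_subspace_sun_star ::
    "(real \<Rightarrow> 'a::banach \<Rightarrow>\<^sub>L 'a) \<Rightarrow> 'a dual_fun set \<Rightarrow> bool" where
  "closed_subspace_sun_star S Y \<longleftrightarrow>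
     (\<lambda>_. 0) \<in> Y \<and>
     (\<forall>l\<in>Y. \<forall>m\<in>Y. (\<lambda>x'. l x' + m x') \<in> Y) \<and>
     (\<forall>c. \<forall>l\<in>Y. (\<lambda>x'. c * l x') \<in> Y) \<and>
     closedin (sun_star_topology S) Y"

definition admissible_range ::
    "(real \<Rightarrow> 'a::banach \<Rightarrow>\<^sub>L 'a) \<Rightarrow> 'a dual_fun set \<Rightarrow> bool" where
  "admissible_range S Y \<longleftrightarrow>
     closed_subspace_sun_star S Y \<and>
     (\<exists>J :: real set. is_interval J \<and> (\<exists>a\<in>J. \<exists>b\<in>J. a < b) \<and>
        (\<forall>f. continuous_map (top_of_set J) (sun_star_topology S) f \<and> f ` J \<subseteq> Y \<longrightarrow>
           (\<forall>s\<in>J. \<forall>t\<in>J. s \<le> t \<longrightarrow>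
              weak_star_integral s t (\<lambda>\<tau>. sun_star_semigroup S (t - \<tau>) (f \<tau>))
                \<in> range (sun_embed S))))"

definition admissible_perturbation ::
    "(real \<Rightarrow> 'a::banach \<Rightarrow>\<^sub>L 'a) \<Rightarrow> ('a \<Rightarrow> 'a dual_fun) \<Rightarrow> bool" where
  "admissible_perturbation S G \<longleftrightarrow>
     continuous_map euclidean (sun_star_topology S) G \<and>
     (\<exists>Y. admissible_range S Y \<and> range G \<subseteq> Y)"


section \<open>Differentiability of maps into the dual of the sun dual\<close>

definition has_sun_star_derivative ::
    "(real \<Rightarrow> 'a::banach \<Rightarrow>\<^sub>L 'a) \<Rightarrow> ('a \<Rightarrow> 'a dual_fun) \<Rightarrow> ('a \<Rightarrow> 'a dual_fun) \<Rightarrow> 'a \<Rightarrow> bool" where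
  "has_sun_star_derivative S G L x \<longleftrightarrow>
     (\<forall>h. L h \<in> sun_star S) \<and>
     (\<forall>x'. linear (\<lambda>h. L h x')) \<and>
     (\<exists>C. \<forall>h. sun_star_norm S (L h) \<le> C * norm h) \<and>
     ((\<lambda>h. sun_star_norm S (\<lambda>x'. G (x + h) x' - G x x' - L h x') / norm h) \<longlongrightarrow> 0) (at 0)"

text \<open>
  An \<open>n\<close>-linear map is a function on lists, of which only the values on lists of length \<open>n\<close> matter.
  Linearity in a slot may be tested pointwise because the operations on functionals are pointwise.
\<close>

definition bounded_multilinear ::
    "(real \<Rightarrow> 'a::banach \<Rightarrow>\<^sub>L 'a) \<Rightarrow> nat \<Rightarrow> ('a list \<Rightarrow> 'a dual_fun) \<Rightarrow> bool" where
  "bounded_multilinear S n M \<longleftrightarrow>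
     (\<forall>vs. length vs = n \<longrightarrow> M vs \<in> sun_star S) \<and>
     (\<forall>vs i x'. length vs = n \<and> i < n \<longrightarrow> linear (\<lambda>v. M (vs[i := v]) x')) \<and>
     (\<exists>C. \<forall>vs. length vs = n \<longrightarrow> sun_star_norm S (M vs) \<le> C * (\<Prod>v\<leftarrow>vs. norm v))"

definition multilinear_norm ::
    "(real \<Rightarrow> 'a::banach \<Rightarrow>\<^sub>L 'a) \<Rightarrow> nat \<Rightarrow> ('a list \<Rightarrow> 'a dual_fun) \<Rightarrow> real" where
  "multilinear_norm S n M =
     (SUP vs\<in>{vs. length vs = n \<and> (\<forall>v\<in>set vs. norm v \<le> 1)}. sun_star_norm S (M vs))"

text \<open>
  \<open>D n x\<close> is the \<open>n\<close>-th Frechet derivative of \<open>G\<close> at \<open>x\<close>. The derivative at \<open>x\<close> of \<open>D n\<close>, a bounded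
  linear map into the bounded \<open>n\<close>-linear maps, is identified with the \<open>(n + 1)\<close>-linear map
  \<open>D (Suc n) x\<close>: its value in direction \<open>h\<close> is \<open>\<lambda>vs. D (Suc n) x (h # vs)\<close>. Both limits are with
  respect to the operator norm.
\<close>

definition Ck_sun_star ::
    "(real \<Rightarrow> 'a::banach \<Rightarrow>\<^sub>L 'a) \<Rightarrow> nat \<Rightarrow> ('a \<Rightarrow> 'a dual_fun) \<Rightarrow> bool" where
  "Ck_sun_star S k G \<longleftrightarrow>
     (\<exists>D :: nat \<Rightarrow> 'a \<Rightarrow> 'a list \<Rightarrow> 'a dual_fun.
        (\<forall>x. D 0 x [] = G x) \<and>
        (\<forall>n\<le>k. \<forall>x. bounded_multilinear S n (D n x)) \<and>
        (\<forall>n<k. \<forall>x.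
           ((\<lambda>h. multilinear_norm S n
                   (\<lambda>vs x'. D n (x + h) vs x' - D n x vs x' - D (Suc n) x (h # vs) x') / norm h)
             \<longlongrightarrow> 0) (at 0)) \<and>
        (\<forall>x. ((\<lambda>y. multilinear_norm S k (\<lambda>vs x'. D k y vs x' - D k x vs x')) \<longlongrightarrow> 0) (at x)))"


section \<open>The semiflow and the perturbed semigroup\<close>

definition solution_on ::
    "(real \<Rightarrow> 'a::banach \<Rightarrow>\<^sub>L 'a) \<Rightarrow> ('a \<Rightarrow> 'a dual_fun) \<Rightarrow> 'a \<Rightarrow> real set \<Rightarrow> (real \<Rightarrow> 'a) \<Rightarrow> bool" where
  "solution_on S G \<phi> J u \<longleftrightarrow>
     is_interval J \<and> 0 \<in> J \<and> J \<subseteq> {0..} \<and> continuous_on J u \<and>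
     (\<forall>t\<in>J.
        let I = weak_star_integral 0 t (\<lambda>\<tau>. sun_star_semigroup S (t - \<tau>) (G (u \<tau>)))
        in I \<in> range (sun_embed S) \<and> u t = S t \<phi> + inv (sun_embed S) I)"

definition maximal_solution ::
    "(real \<Rightarrow> 'a::banach \<Rightarrow>\<^sub>L 'a) \<Rightarrow> ('a \<Rightarrow> 'a dual_fun) \<Rightarrow> 'a \<Rightarrow> real set \<Rightarrow> (real \<Rightarrow> 'a) \<Rightarrow> bool" where
  "maximal_solution S G \<phi> J u \<longleftrightarrow>
     solution_on S G \<phi> J u \<and>
     (\<forall>J' u'. solution_on S G \<phi> J' u' \<and> J \<subseteq> J' \<and> (\<forall>t\<in>J. u' t = u t) \<longrightarrow> J' = J)"

definition existence_interval ::
    "(real \<Rightarrow> 'a::banach \<Rightarrow>\<^sub>L 'a) \<Rightarrow> ('a \<Rightarrow> 'a dual_fun) \<Rightarrow> 'a \<Rightarrow> real set" where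
  "existence_interval S G \<phi> = (THE J. \<exists>u. maximal_solution S G \<phi> J u)"

text \<open>
  A maximal solution is unique only as a function on its interval, so the semiflow is meaningful
  only for \<open>t\<close> in \<open>existence_interval S G \<phi>\<close>.
\<close>

definition semiflow ::
    "(real \<Rightarrow> 'a::banach \<Rightarrow>\<^sub>L 'a) \<Rightarrow> ('a \<Rightarrow> 'a dual_fun) \<Rightarrow> real \<Rightarrow> 'a \<Rightarrow> 'a" where
  "semiflow S G t \<phi> =
     (THE y. \<exists>u. maximal_solution S G \<phi> (existence_interval S G \<phi>) u \<and> y = u t)"

definition equilibrium ::
    "(real \<Rightarrow> 'a::banach \<Rightarrow>\<^sub>L 'a) \<Rightarrow> ('a \<Rightarrow> 'a dual_fun) \<Rightarrow> 'a \<Rightarrow> bool" where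
  "equilibrium S G \<phi> \<longleftrightarrow>
     existence_interval S G \<phi> = {0..} \<and> (\<forall>t\<ge>0. semiflow S G t \<phi> = \<phi>)"

definition perturbed_semigroup ::
    "(real \<Rightarrow> 'a::banach \<Rightarrow>\<^sub>L 'a) \<Rightarrow> ('a \<Rightarrow> 'a dual_fun) \<Rightarrow> (real \<Rightarrow> 'a \<Rightarrow>\<^sub>L 'a) \<Rightarrow> bool" where
  "perturbed_semigroup S L T \<longleftrightarrow>
     C0_semigroup T \<and>
     (\<forall>x. \<forall>t\<ge>0.
        let I = weak_star_integral 0 t (\<lambda>\<tau>. sun_star_semigroup S (t - \<tau>) (L (T \<tau> x)))
        in I \<in> range (sun_embed S) \<and> T t x = S t x + inv (sun_embed S) I)"

end

theory Submission
  imports Defs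
begin

text \<open>
  The reason is variation of constants. Let \<open>u\<close> be the orbit of \<open>\<phi>\<close>, let \<open>h = \<phi> - \<phi>\<^sub>0\<close> and let
  \<open>w t = u t - \<phi>\<^sub>0 - T t h\<close>. The orbit \<open>u\<close>, the equilibrium \<open>\<phi>\<^sub>0\<close> and the linear orbit \<open>T t h\<close> all
  satisfy integral equations with the same unperturbed semigroup. Subtracting them cancels the terms
  that contain the initial data and leaves
  \<open>j (w t) = \<integral> T0(t - \<tau>) [(G (u \<tau>) - G \<phi>\<^sub>0 - L (u \<tau> - \<phi>\<^sub>0)) + L (w \<tau>)] d\<tau>\<close>, where
  \<open>T0\<close> stands for its second adjoint on the dual of the sun dual.
  If \<open>norm (u \<tau> - \<phi>\<^sub>0) \<le> C * norm h\<close> on the whole time interval, then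
  differentiability of \<open>G\<close> at \<open>\<phi>\<^sub>0\<close> makes the first bracket at most \<open>\<eta> * C * norm h\<close>, with \<open>\<eta>\<close> as small as
  desired, and Gronwall's inequality gives \<open>norm (w t) \<le> \<epsilon> * norm h\<close>.

  To read a norm estimate in \<open>X\<close> off this equation one needs \<open>norm x\<close> to be controlled by the values of
  \<open>x\<close> on the sun dual (\<open>norm_le_sun_bound\<close>). By the Hahn--Banach theorem the full dual norms \<open>X\<close>, and
  every functional is a pointwise limit of its averages along the adjoint semigroup; these averages lie
  in the sun dual and are bounded uniformly. This yields the estimate \<open>mild_difference_bound\<close>, on which
  every later comparison of two solutions rests, and the injectivity of \<open>j\<close>.

  It remains to produce orbits that exist long enough and stay close (\<open>solution_near_equilibrium\<close>).
  Being continuously differentiable, \<open>G\<close> is locally Lipschitz (\<open>Ck_locally_lipschitz\<close>). Composing \<open>G\<close> with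
  a radial retraction onto a ball around \<open>\<phi>\<^sub>0\<close> makes it globally Lipschitz and leaves its range inside the
  admissible range. The integral equation for the truncated map is solved on any prescribed interval
  by a contraction in an exponentially weighted norm (\<open>lipschitz_solution_exists\<close>); that the contraction
  maps into \<open>X\<close> is where admissibility enters, after it has been carried from one interval to all of
  them (\<open>duhamel_in_range\<close>). Gronwall's inequality keeps the solution in the ball when \<open>h\<close> is small, so
  it solves the original equation.

  Finally, solutions agree on common intervals (\<open>solution_unique\<close>), hence the union of all solutions is
  the greatest one, and it is the one that the semiflow describes (\<open>semiflow_eq_greatest_solution\<close>).
\<close>

section \<open>The Hahn--Banach theorem\<close>

definition sublinear :: "('a::real_vector \<Rightarrow> real) \<Rightarrow> bool" where
  "sublinear p \<longleftrightarrow> (\<forall>x y. p (x + y) \<le> p x + p y) \<and> (\<forall>c\<ge>0. \<forall>x. p (c *\<^sub>R x) = c * p x)"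

lemma sublinear_add: "sublinear p \<Longrightarrow> p (x + y) \<le> p x + p y"
  by (simp add: sublinear_def)

lemma sublinear_scaleR: "sublinear p \<Longrightarrow> 0 \<le> c \<Longrightarrow> p (c *\<^sub>R x) = c * p x"
  by (simp add: sublinear_def)

lemma sublinear_zero: "sublinear p \<Longrightarrow> p 0 = 0"
  using sublinear_scaleR[of p 0 0] by simp

lemma sublinear_lower: "sublinear p \<Longrightarrow> - p (- x) \<le> p x"
  using sublinear_add[of p x "- x"] sublinear_zero[of p] by simp

lemma sublinear_norm: "sublinear (norm :: 'a::real_normed_vector \<Rightarrow> real)"
  by (simp add: sublinear_def norm_triangle_ineq)

text \<open>
  The infimum over \<open>t \<ge> 0\<close> of \<open>p (x + t y) - t p y\<close> is again sublinear. It is the step that makes \<open>p\<close>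
  smaller whenever \<open>p\<close> fails to be odd at \<open>y\<close>: at \<open>x = - y\<close> and \<open>t = 1\<close> the expression is \<open>- p y\<close>.
\<close>

lemma sublinear_shrink:
  assumes p: "sublinear p"
  obtains q where "sublinear q" "\<And>x. q x \<le> p x" "q (- y) \<le> - p y"
proof -
  define F where "F x t = p (x + t *\<^sub>R y) - t * p y" for x and t :: real
  define q where "q x = (INF t\<in>{0..}. F x t)" for x
  have low: "- p (- x) \<le> F x t" if "t \<ge> 0" for x t
  proof -
    have "t * p y = p ((x + t *\<^sub>R y) + (- x))"
      using sublinear_scaleR[OF p that] by simp
    also have "\<dots> \<le> p (x + t *\<^sub>R y) + p (- x)" by (rule sublinear_add[OF p])
    finally show ?thesis by (simp add: F_def)
  qed
  have bdd: "bdd_below (F x ` {0..})" for x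
    using low[of _ x] by (auto intro!: bdd_belowI2)
  have qF: "q x \<le> F x t" if "t \<ge> 0" for x t
    unfolding q_def using that by (intro cINF_lower bdd) auto
  have qI: "a \<le> q x" if "\<And>t. t \<ge> 0 \<Longrightarrow> a \<le> F x t" for a x
    unfolding q_def using that by (intro cINF_greatest) auto
  have qp: "q x \<le> p x" for x using qF[of 0 x] by (simp add: F_def)
  have "q (- y) \<le> - p y" using qF[of 1 "- y"] sublinear_zero[OF p] by (simp add: F_def)
  moreover have "sublinear q"
    unfolding sublinear_def
  proof (intro conjI allI impI)
    fix x z
    have 1: "q (x + z) \<le> F x s + F z t" if "s \<ge> 0" "t \<ge> 0" for s t
    proof -
      have "q (x + z) \<le> F (x + z) (s + t)" using that by (intro qF) simp
      also have "\<dots> \<le> F x s + F z t"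
        using sublinear_add[OF p, of "x + s *\<^sub>R y" "z + t *\<^sub>R y"]
        by (simp add: F_def algebra_simps)
      finally show ?thesis .
    qed
    have "q (x + z) - F x s \<le> q z" if "s \<ge> 0" for s
      using 1[OF that] by (intro qI) (simp add: algebra_simps)
    then have "q (x + z) - q z \<le> q x"
      by (intro qI) (simp add: algebra_simps)
    then show "q (x + z) \<le> q x + q z" by simp
  next
    fix c :: real and x assume c: "c \<ge> 0"
    have le: "q (c *\<^sub>R x) \<le> c * q x" if "c > 0" for c x
    proof -
      have "q (c *\<^sub>R x) / c \<le> F x t" if "t \<ge> 0" for t
      proof -
        have "q (c *\<^sub>R x) \<le> F (c *\<^sub>R x) (c * t)" using that \<open>c > 0\<close> by (intro qF) simp
        also have "\<dots> = c * F x t"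
          using sublinear_scaleR[OF p, of c "x + t *\<^sub>R y"] \<open>c > 0\<close>
          by (simp add: F_def algebra_simps)
        finally show ?thesis using \<open>c > 0\<close> by (simp add: field_simps)
      qed
      then have "q (c *\<^sub>R x) / c \<le> q x" by (rule qI)
      then show ?thesis using \<open>c > 0\<close> by (simp add: field_simps)
    qed
    show "q (c *\<^sub>R x) = c * q x"
    proof (cases "c = 0")
      case True
      have "q 0 \<ge> 0" using low[of _ 0] sublinear_zero[OF p] by (intro qI) auto
      with qp[of 0] sublinear_zero[OF p] True show ?thesis by simp
    next
      case False
      with c have "c > 0" by simp
      with le[of "1 / c" "c *\<^sub>R x"] have "q x \<le> 1 / c * q (c *\<^sub>R x)" by simp
      with le[OF \<open>c > 0\<close>, of x] \<open>c > 0\<close> show ?thesis by (simp add: field_simps)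
    qed
  qed
  ultimately show ?thesis using qp that by blast
qed

text \<open>
  Shrinking at \<open>y\<close> cannot change a minimal functional, so it is odd at every \<open>y\<close>; oddness turns
  subadditivity into additivity. Working with minimal functionals avoids extending functionals from
  subspaces.
\<close>

lemma minimal_sublinear_linear:
  assumes p: "sublinear p" and min: "\<And>q. sublinear q \<Longrightarrow> (\<And>x. q x \<le> p x) \<Longrightarrow> q = p"
  shows "linear p"
proof -
  have neg: "p (- y) = - p y" for y
  proof -
    obtain q where "sublinear q" "\<And>x. q x \<le> p x" "q (- y) \<le> - p y"
      using sublinear_shrink[OF p] by metis
    with min have "p (- y) \<le> - p y" by blast
    with sublinear_lower[OF p, of y] show ?thesis by simp
  qed
  show ?thesis
  proof (rule linearI)
    fix x y
    have "p x \<le> p (x + y) + p (- y)" using sublinear_add[OF p, of "x + y" "- y"] by simp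
    with sublinear_add[OF p, of x y] show "p (x + y) = p x + p y" by (simp add: neg)
  next
    fix c x
    show "p (c *\<^sub>R x) = c *\<^sub>R p x"
    proof (cases "c \<ge> 0")
      case False
      then have "p ((- c) *\<^sub>R x) = (- c) * p x" by (intro sublinear_scaleR p) simp
      then show ?thesis using neg[of "c *\<^sub>R x"] by simp
    qed (simp add: sublinear_scaleR[OF p])
  qed
qed

text \<open>
  Zorn's lemma for the reversed pointwise order. The infimum of a chain exists because all its members
  lie above \<open>- P (- x)\<close>; it is subadditive because two members of a chain can be replaced by the smaller
  one.
\<close>

theorem linear_below_sublinear:
  assumes P: "sublinear P"
  obtains f where "linear f" "\<And>x. f x \<le> P x"
proof -
  define A where "A = {p. sublinear p \<and> (\<forall>x. p x \<le> P x)}"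
  define R where "R p q \<longleftrightarrow> (\<forall>x. q x \<le> p x)" for p q :: "'a \<Rightarrow> real"
  have R_trans: "R p r" if "R p q" "R q r" for p q r
    unfolding R_def
  proof
    fix x show "r x \<le> p x" using that[unfolded R_def, rule_format, of x] by linarith
  qed
  have "partial_order_on A (relation_of R A)"
    unfolding partial_order_on_def preorder_on_def refl_on_def trans_def antisym_def relation_of_def
    using R_trans by (auto simp: R_def intro!: ext order.antisym)
  moreover have "\<exists>u\<in>A. \<forall>a\<in>C. R a u" if C: "C \<in> Chains (relation_of R A)" for C
  proof (cases "C = {}")
    case True
    then show ?thesis using P by (auto simp: A_def)
  next
    case False
    have CA: "p \<in> A" if "p \<in> C" for p using C that by (auto simp: Chains_def relation_of_def)
    have tot: "R p q \<or> R q p" if "p \<in> C" "q \<in> C" for p q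
      using C that by (auto simp: Chains_def relation_of_def)
    have Cs: "sublinear p" "p x \<le> P x" if "p \<in> C" for p x using CA[OF that] by (auto simp: A_def)
    define u where "u x = (INF p\<in>C. p x)" for x
    have low: "- P (- x) \<le> p x" if "p \<in> C" for p x
      using sublinear_lower[OF Cs(1)[OF that], of x] Cs(2)[OF that, of "- x"] by linarith
    have bdd: "bdd_below ((\<lambda>p. p x) ` C)" for x
      using low by (auto intro!: bdd_belowI2)
    have up: "u x \<le> p x" if "p \<in> C" for p x
      unfolding u_def using that by (intro cINF_lower bdd)
    have uI: "a \<le> u x" if "\<And>p. p \<in> C \<Longrightarrow> a \<le> p x" for a x
      unfolding u_def using that False by (intro cINF_greatest) auto
    obtain p0 where p0: "p0 \<in> C" using False by blast
    have "sublinear u"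
      unfolding sublinear_def
    proof (intro conjI allI impI)
      fix x y
      have 1: "u (x + y) \<le> p x + q y" if "p \<in> C" "q \<in> C" for p q
      proof -
        have "R p q \<or> R q p" using that by (rule tot)
        then obtain r where "r \<in> C" "r x \<le> p x" "r y \<le> q y"
          using \<open>p \<in> C\<close> \<open>q \<in> C\<close> unfolding R_def by blast
        with up[of r "x + y"] sublinear_add[OF Cs(1), of r x y] show ?thesis by linarith
      qed
      have "u (x + y) - p x \<le> u y" if "p \<in> C" for p
        using 1[OF that] by (intro uI) (simp add: algebra_simps)
      then have "u (x + y) - u y \<le> u x" by (intro uI) (simp add: algebra_simps)
      then show "u (x + y) \<le> u x + u y" by simp
    next
      fix c :: real and x assume c: "c \<ge> 0"
      show "u (c *\<^sub>R x) = c * u x"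
      proof (cases "c = 0")
        case True
        have "u 0 = 0"
          using up[OF p0, of 0] uI[of 0 0] sublinear_zero[OF Cs(1)] p0 by fastforce
        with True show ?thesis by simp
      next
        case False
        with c have c: "c > 0" by simp
        have "u (c *\<^sub>R x) / c \<le> u x"
        proof (rule uI)
          fix p assume p: "p \<in> C"
          show "u (c *\<^sub>R x) / c \<le> p x"
            using up[OF p, of "c *\<^sub>R x"] sublinear_scaleR[OF Cs(1)[OF p], of c x] c
            by (simp add: field_simps)
        qed
        moreover have "c * u x \<le> u (c *\<^sub>R x)"
        proof (rule uI)
          fix p assume p: "p \<in> C"
          show "c * u x \<le> p (c *\<^sub>R x)"
            using up[OF p, of x] sublinear_scaleR[OF Cs(1)[OF p], of c x] c
            by (simp add: field_simps)
        qed
        ultimately show ?thesis using c by (simp add: field_simps)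
      qed
    qed
    moreover have "u x \<le> P x" for x using up[OF p0, of x] Cs(2)[OF p0, of x] by linarith
    ultimately show ?thesis using up by (intro bexI[of _ u]) (auto simp: A_def R_def)
  qed
  ultimately have "\<exists>m\<in>A. \<forall>a\<in>A. R m a \<longrightarrow> a = m" by (rule predicate_Zorn)
  then obtain m where m: "m \<in> A" "\<And>a. a \<in> A \<Longrightarrow> R m a \<Longrightarrow> a = m" by blast
  have "linear m"
  proof (rule minimal_sublinear_linear)
    show "sublinear m" using m(1) by (simp add: A_def)
    fix q assume q: "sublinear q" "\<And>x. q x \<le> m x"
    have "q x \<le> P x" for x using m(1) q(2)[of x] by (auto simp: A_def intro: order.trans)
    then have "q \<in> A" using q(1) by (simp add: A_def)
    then show "q = m" using m(2) q(2) by (simp add: R_def)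
  qed
  then show ?thesis using m(1) that by (auto simp: A_def)
qed

text \<open>
  Shrinking the norm at \<open>x\<close> before applying Hahn--Banach forces \<open>f (- x) \<le> - norm x\<close>.
\<close>

corollary norming_functional:
  fixes x :: "'a::real_normed_vector"
  obtains f :: "'a \<Rightarrow>\<^sub>L real" where "f x = norm x" "norm f \<le> 1"
proof -
  obtain q where q: "sublinear q" "\<And>z. q z \<le> norm z" "q (- x) \<le> - norm x"
    using sublinear_shrink[OF sublinear_norm] by metis
  obtain f where f: "linear f" "\<And>z. f z \<le> q z"
    using linear_below_sublinear[OF q(1)] by metis
  have le: "f z \<le> norm z" for z using f(2)[of z] q(2)[of z] by linarith
  have bound: "\<bar>f z\<bar> \<le> norm z" for z
    using le[of z] le[of "- z"] linear_neg[OF f(1), of z] by auto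
  have bl: "bounded_linear f"
    using f(1) bound by (intro bounded_linear_intro[where K = 1]) (auto simp: linear_iff)
  have "f x = norm x"
    using f(2)[of "- x"] q(3) linear_neg[OF f(1), of x] le[of x] by simp
  moreover have "norm (Blinfun f) \<le> 1"
    using bound by (intro norm_blinfun_bound) (simp_all add: bounded_linear_Blinfun_apply bl)
  ultimately show ?thesis by (intro that[of "Blinfun f"]) (simp_all add: bounded_linear_Blinfun_apply bl)
qed

section \<open>Boundedness and continuity of strongly continuous semigroups\<close>

text \<open>
  By Baire's theorem one of the closed sets \<open>F k\<close>, on which all operators are bounded by \<open>k\<close>, contains a
  ball.
\<close>

lemma uniform_boundedness:
  fixes A :: "nat \<Rightarrow> 'a::banach \<Rightarrow>\<^sub>L 'b::real_normed_vector"
  assumes "\<And>x. bounded (range (\<lambda>n. A n x))"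
  shows "bounded (range A)"
proof -
  define F where "F k = {x. \<forall>n. norm (A n x) \<le> real k}" for k
  have clF: "closed (F k)" for k
    unfolding F_def by (intro closed_Collect_all closed_Collect_le continuous_intros)
  have cover: "\<Union> (range F) = UNIV"
  proof (intro equalityI subsetI UNIV_I)
    fix x
    obtain B where B: "\<And>n. norm (A n x) \<le> B"
      using assms[of x] by (auto simp: bounded_iff)
    obtain k where "B \<le> real k" using real_arch_simple by blast
    then have "x \<in> F k" using B by (auto simp: F_def intro: order.trans)
    then show "x \<in> \<Union> (range F)" by blast
  qed
  have "\<exists>k. interior (F k) \<noteq> {}"
  proof (rule ccontr)
    assume "\<nexists>k. interior (F k) \<noteq> {}"
    then have "Met_TC.mtopology interior_of \<Union> (range F) = {}"
      using clF by (intro Met_TC.metric_Baire_category_alt) auto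
    with cover show False by simp
  qed
  then obtain k x0 where "x0 \<in> interior (F k)" by blast
  then obtain r where r: "r > 0" "cball x0 r \<subseteq> F k"
    using mem_interior_cball by blast
  have "norm (A n) \<le> 2 * real k / r" for n
  proof (rule norm_blinfun_bound)
    fix z
    show "norm (A n z) \<le> 2 * real k / r * norm z"
    proof (cases "z = 0")
      case False
      define y where "y = (r / norm z) *\<^sub>R z"
      have "norm y = r" using False r by (simp add: y_def)
      then have "x0 + y \<in> F k" "x0 \<in> F k" using r by (auto intro!: subsetD[OF r(2)] simp: dist_norm)
      then have "norm (A n (x0 + y)) \<le> k" "norm (A n x0) \<le> k" by (auto simp: F_def)
      moreover have "A n y = A n (x0 + y) - A n x0" by (simp add: blinfun.bilinear_simps)
      ultimately have "norm (A n y) \<le> 2 * k"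
        using norm_triangle_ineq4[of "A n (x0 + y)" "A n x0"] by simp
      moreover have "norm (A n y) = r / norm z * norm (A n z)"
        using r by (simp add: y_def blinfun.bilinear_simps)
      ultimately show ?thesis using False r by (simp add: field_simps)
    qed simp
  qed (use r in simp)
  then show ?thesis by (auto simp: bounded_iff)
qed

lemma C0_semigroup_add:
  "C0_semigroup S \<Longrightarrow> 0 \<le> s \<Longrightarrow> 0 \<le> t \<Longrightarrow> S (s + t) = S s o\<^sub>L S t"
  by (simp add: C0_semigroup_def)

lemma C0_semigroup_0: "C0_semigroup S \<Longrightarrow> S 0 = id_blinfun"
  by (simp add: C0_semigroup_def)

text \<open>
  Otherwise there are times tending to \<open>0\<close> along which the operators are unbounded in norm, although they
  converge pointwise.
\<close>

lemma C0_semigroup_bounded_near_0: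
  assumes C0: "C0_semigroup S"
  obtains \<delta> M where "\<delta> > 0" "\<And>t. 0 \<le> t \<Longrightarrow> t \<le> \<delta> \<Longrightarrow> norm (S t) \<le> M"
proof -
  have "\<exists>n. \<forall>t. 0 \<le> t \<and> t \<le> 1 / Suc n \<longrightarrow> norm (S t) \<le> real n"
  proof (rule ccontr)
    assume "\<nexists>n. \<forall>t. 0 \<le> t \<and> t \<le> 1 / Suc n \<longrightarrow> norm (S t) \<le> real n"
    then have "\<forall>n. \<exists>t. 0 \<le> t \<and> t \<le> 1 / Suc n \<and> norm (S t) > real n" by (auto simp: not_le)
    then obtain \<tau> where \<tau>: "\<And>n. 0 \<le> \<tau> n" "\<And>n. \<tau> n \<le> 1 / Suc n" "\<And>n. norm (S (\<tau> n)) > real n"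
      by metis
    have \<tau>0: "\<tau> \<longlonglongrightarrow> 0"
      using \<tau>(1,2) LIMSEQ_Suc[OF lim_1_over_n]
      by (intro tendsto_sandwich[of "\<lambda>_. 0" \<tau> _ "\<lambda>n. 1 / Suc n"]) (auto intro!: always_eventually)
    have "bounded (range (\<lambda>n. S (\<tau> n) x))" for x
    proof -
      have "((\<lambda>t. S t x) \<longlongrightarrow> x) (at_right 0)" using C0 by (simp add: C0_semigroup_def)
      then have "((\<lambda>t. S t x) \<longlongrightarrow> S 0 x) (at 0 within {0..})"
        using C0_semigroup_0[OF C0] by (simp add: at_within_Ici_at_right)
      then have "((\<lambda>n. S (\<tau> n) x) \<longlongrightarrow> S 0 x) sequentially"
        using \<tau>0 \<tau>(1)
        by (intro continuous_within_tendsto_compose'[where S = "{0..}" and f = "\<lambda>t. S t x"])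
          (auto simp: continuous_within)
      then show ?thesis by (rule convergent_imp_bounded)
    qed
    then have "bounded (range (\<lambda>n. S (\<tau> n)))" by (rule uniform_boundedness)
    then obtain B where B: "\<And>n. norm (S (\<tau> n)) \<le> B" by (auto simp: bounded_iff)
    obtain n where "B \<le> real n" using real_arch_simple by blast
    with B[of n] \<tau>(3)[of n] show False by simp
  qed
  then obtain n where "\<And>t. 0 \<le> t \<Longrightarrow> t \<le> 1 / Suc n \<Longrightarrow> norm (S t) \<le> real n" by blast
  then show ?thesis using that[of "1 / Suc n" "real n"] by simp
qed

lemma C0_semigroup_bounded:
  assumes C0: "C0_semigroup S"
  obtains M where "1 \<le> M" "\<And>t. 0 \<le> t \<Longrightarrow> t \<le> b \<Longrightarrow> norm (S t) \<le> M"
proof -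
  obtain \<delta> M0 where \<delta>: "\<delta> > 0" and M0: "\<And>t. 0 \<le> t \<Longrightarrow> t \<le> \<delta> \<Longrightarrow> norm (S t) \<le> M0"
    using C0_semigroup_bounded_near_0[OF C0] by metis
  define M where "M = max 1 M0"
  have M: "norm (S t) \<le> M" if "0 \<le> t" "t \<le> \<delta>" for t using M0[OF that] by (simp add: M_def)
  have M1: "1 \<le> M" by (simp add: M_def)
  \<comment> \<open>A time up to \<open>n * \<delta>\<close> is a sum of \<open>n\<close> times in \<open>[0, \<delta>]\<close>.\<close>
  have pow: "norm (S t) \<le> M ^ n" if "0 \<le> t" "t \<le> real n * \<delta>" "n > 0" for n t
    using that
  proof (induction n arbitrary: t)
    case (Suc n)
    show ?case
    proof (cases "t \<le> \<delta>")
      case True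
      have "norm (S t) \<le> M ^ 1" using M[OF Suc.prems(1) True] by simp
      also have "\<dots> \<le> M ^ Suc n" using M1 by (intro power_increasing) auto
      finally show ?thesis .
    next
      case False
      have n: "n > 0" using False Suc.prems \<delta> by (cases n) auto
      have "S t = S \<delta> o\<^sub>L S (t - \<delta>)"
        using C0_semigroup_add[OF C0, of \<delta> "t - \<delta>"] False \<delta> by simp
      then have "norm (S t) \<le> norm (S \<delta>) * norm (S (t - \<delta>))"
        by (simp add: norm_blinfun_compose)
      also have "\<dots> \<le> M * M ^ n"
        using M[of \<delta>] \<delta> M1 Suc.IH[of "t - \<delta>"] Suc.prems False n
        by (intro mult_mono) (auto simp: algebra_simps)
      finally show ?thesis by simp
    qed
  qed simp
  obtain n :: nat where "b / \<delta> \<le> real n" using real_arch_simple by blast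
  then have "b \<le> real (Suc n) * \<delta>" using \<delta> by (simp add: field_simps)
  then have "norm (S t) \<le> M ^ Suc n" if "0 \<le> t" "t \<le> b" for t
    using that by (intro pow) auto
  moreover have "1 \<le> M ^ Suc n" using M1 by (intro one_le_power)
  ultimately show ?thesis using that by blast
qed

text \<open>
  The common reason why orbits of a semigroup, and adjoint orbits in the sun dual, are continuous: the
  semigroup law bounds the increment over \<open>[s, s + h]\<close> by a multiple of the increment over \<open>[0, h]\<close>, with a
  constant that is uniform for \<open>s\<close> in bounded sets. Uniformity is what gives continuity from the left.
\<close>

lemma locally_bounded_semigroup_continuous_on:
  fixes c :: "real \<Rightarrow> 'b::real_normed_vector"
  assumes 0: "(c \<longlongrightarrow> c 0) (at_right 0)"
    and M: "\<And>b. \<exists>M. \<forall>s h. 0 \<le> s \<and> 0 \<le> h \<and> s \<le> b \<longrightarrow> norm (c (s + h) - c s) \<le> M * norm (c h - c 0)"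
  shows "continuous_on {0..} c"
proof -
  have "continuous (at t within {0..}) c" if t: "t \<ge> 0" for t
  proof -
    obtain M where M: "\<And>s h. 0 \<le> s \<Longrightarrow> 0 \<le> h \<Longrightarrow> s \<le> t + 1 \<Longrightarrow>
        norm (c (s + h) - c s) \<le> M * norm (c h - c 0)"
      using M[of "t + 1"] by blast
    have "((\<lambda>h. norm (c h - c 0)) \<longlongrightarrow> 0) (at 0 within {0..})"
      using 0 tendsto_norm_zero_iff Lim_null by (metis at_within_Ici_at_right)
    then have "((\<lambda>r. norm (c (norm (r - t)) - c 0)) \<longlongrightarrow> 0) (at t within {0..})"
      by (intro continuous_within_tendsto_compose'
            [where S = "{0..}" and a = 0 and f = "\<lambda>h. norm (c h - c 0)", simplified])
        (auto simp: continuous_within intro!: tendsto_eq_intros)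
    then have lim: "((\<lambda>r. M * norm (c \<bar>r - t\<bar> - c 0)) \<longlongrightarrow> 0) (at t within {0..})"
      by (auto intro!: tendsto_mult_right_zero)
    have "\<forall>\<^sub>F r in at t within {0..}. norm (c r - c t) \<le> M * norm (c \<bar>r - t\<bar> - c 0)"
      unfolding eventually_at
    proof (intro exI[of _ 1] conjI ballI impI)
      fix r :: real assume r: "r \<in> {0..}" "r \<noteq> t \<and> dist r t < 1"
      show "norm (c r - c t) \<le> M * norm (c \<bar>r - t\<bar> - c 0)"
      proof (cases "r \<le> t")
        case True
        then show ?thesis using M[of r "t - r"] r by (simp add: norm_minus_commute)
      next
        case False
        then show ?thesis using M[of t "r - t"] t by simp
      qed
    qed simp
    then have "((\<lambda>r. c r - c t) \<longlongrightarrow> 0) (at t within {0..})"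
      using lim by (rule Lim_null_comparison)
    then show ?thesis unfolding continuous_within by (simp add: Lim_null[of c])
  qed
  then show ?thesis by (simp add: continuous_on_eq_continuous_within)
qed

lemma C0_semigroup_continuous_on:
  assumes C0: "C0_semigroup S"
  shows "continuous_on {0..} (\<lambda>t. S t x)"
proof (rule locally_bounded_semigroup_continuous_on)
  show "((\<lambda>t. S t x) \<longlongrightarrow> S 0 x) (at_right 0)"
    using C0 by (simp add: C0_semigroup_def)
  fix b
  obtain M where M: "\<And>t. 0 \<le> t \<Longrightarrow> t \<le> b \<Longrightarrow> norm (S t) \<le> M"
    using C0_semigroup_bounded[OF C0] by metis
  have "norm (S (s + h) x - S s x) \<le> M * norm (S h x - S 0 x)" if "0 \<le> s" "0 \<le> h" "s \<le> b" for s h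
  proof -
    have "S (s + h) x - S s x = S s (S h x - S 0 x)"
      using C0_semigroup_add[OF C0, of s h] C0_semigroup_0[OF C0] that
      by (simp add: blinfun.bilinear_simps)
    also have "norm \<dots> \<le> norm (S s) * norm (S h x - S 0 x)" by (rule norm_blinfun)
    also have "\<dots> \<le> M * norm (S h x - S 0 x)" using M that by (intro mult_right_mono) auto
    finally show ?thesis .
  qed
  then show "\<exists>M. \<forall>s h. 0 \<le> s \<and> 0 \<le> h \<and> s \<le> b \<longrightarrow>
      norm (S (s + h) x - S s x) \<le> M * norm (S h x - S 0 x)" by blast
qed

section \<open>The sun dual\<close>

lemma blinfun_compose_diff_left: "(f - g) o\<^sub>L h = (f o\<^sub>L h) - (g o\<^sub>L h)"
  by (rule blinfun_eqI) (simp add: blinfun.bilinear_simps)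

lemma blinfun_compose_assoc: "f o\<^sub>L g o\<^sub>L h = f o\<^sub>L (g o\<^sub>L h)"
  by (rule blinfun_eqI) simp

lemma sun_adjoint_increment:
  assumes C0: "C0_semigroup S" and "0 \<le> s" "0 \<le> h"
  shows "norm ((x' o\<^sub>L S (s + h)) - (x' o\<^sub>L S s)) \<le> norm (S s) * norm ((x' o\<^sub>L S h) - x')"
proof -
  have "S (s + h) = S h o\<^sub>L S s" using C0_semigroup_add[OF C0, of h s] assms by (simp add: add.commute)
  then have "(x' o\<^sub>L S (s + h)) - (x' o\<^sub>L S s) = ((x' o\<^sub>L S h) - x') o\<^sub>L S s"
    by (simp add: blinfun_compose_diff_left blinfun_compose_assoc)
  then show ?thesis using norm_blinfun_compose[of "(x' o\<^sub>L S h) - x'" "S s"] by (simp add: mult.commute)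
qed

lemma sun_adjoint:
  assumes C0: "C0_semigroup S" and x': "x' \<in> sun S" and s: "0 \<le> s"
  shows "x' o\<^sub>L S s \<in> sun S"
proof -
  have lim: "((\<lambda>h. norm (S s) * norm ((x' o\<^sub>L S h) - x')) \<longlongrightarrow> 0) (at_right 0)"
    using x' by (auto simp: sun_def intro!: tendsto_mult_right_zero)
  have "\<forall>\<^sub>F h in at_right 0. norm (norm (((x' o\<^sub>L S s) o\<^sub>L S h) - (x' o\<^sub>L S s)))
      \<le> norm (S s) * norm ((x' o\<^sub>L S h) - x')"
  proof (rule eventually_at_right_less[THEN eventually_mono])
    fix h :: real assume "0 < h"
    then show "norm (norm (((x' o\<^sub>L S s) o\<^sub>L S h) - (x' o\<^sub>L S s)))
        \<le> norm (S s) * norm ((x' o\<^sub>L S h) - x')"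
      using sun_adjoint_increment[OF C0 s, of h x'] C0_semigroup_add[OF C0 s, of h]
      by (simp add: blinfun_compose_assoc)
  qed
  from Lim_null_comparison[OF this lim] show ?thesis by (simp add: sun_def)
qed

lemma sun_orbit_continuous_on:
  assumes C0: "C0_semigroup S" and x': "x' \<in> sun S"
  shows "continuous_on {0..} (\<lambda>t. x' o\<^sub>L S t)"
proof (rule locally_bounded_semigroup_continuous_on)
  have z: "x' o\<^sub>L S 0 = x'" using C0_semigroup_0[OF C0] by (simp add: blinfun_eqI)
  show "((\<lambda>t. x' o\<^sub>L S t) \<longlongrightarrow> x' o\<^sub>L S 0) (at_right 0)"
    using x' by (simp add: z sun_def Lim_null[of "\<lambda>t. x' o\<^sub>L S t"] tendsto_norm_zero_iff)
  fix b
  obtain M where M: "\<And>t. 0 \<le> t \<Longrightarrow> t \<le> b \<Longrightarrow> norm (S t) \<le> M"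
    using C0_semigroup_bounded[OF C0] by metis
  have "norm ((x' o\<^sub>L S (s + h)) - (x' o\<^sub>L S s)) \<le> M * norm ((x' o\<^sub>L S h) - (x' o\<^sub>L S 0))"
    if "0 \<le> s" "0 \<le> h" "s \<le> b" for s h
    using order.trans[OF sun_adjoint_increment[OF C0 that(1,2), of x']
        mult_right_mono[OF M[OF that(1,3)], of "norm ((x' o\<^sub>L S h) - x')"]] by (simp add: z)
  then show "\<exists>M. \<forall>s h. 0 \<le> s \<and> 0 \<le> h \<and> s \<le> b \<longrightarrow>
      norm ((x' o\<^sub>L S (s + h)) - (x' o\<^sub>L S s)) \<le> M * norm ((x' o\<^sub>L S h) - (x' o\<^sub>L S 0))" by blast
qed

text \<open>
  A norming functional \<open>f\<close> of \<open>x\<close> need not lie in the sun dual, but its average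
  \<open>Y y = (1 / t) * \<integral> f (S \<tau> y) d\<tau>\<close> over \<open>[0, t]\<close> does: translating by \<open>h\<close> changes the integral only by two
  pieces of length \<open>h\<close>. The average has norm at most \<open>M\<close>, and \<open>Y x\<close> tends to \<open>f x = norm x\<close> as \<open>t\<close> tends
  to \<open>0\<close>.
\<close>

theorem norm_le_sun_bound:
  assumes C0: "C0_semigroup S" and M: "\<And>t. 0 \<le> t \<Longrightarrow> t \<le> 1 \<Longrightarrow> norm (S t) \<le> M"
    and K: "0 \<le> K" "\<And>x'. x' \<in> sun S \<Longrightarrow> \<bar>blinfun_apply x' x\<bar> \<le> K * norm x'"
  shows "norm x \<le> K * M"
proof -
  obtain f :: "'a \<Rightarrow>\<^sub>L real" where f: "f x = norm x" "norm f \<le> 1" by (rule norming_functional)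
  have M0: "0 \<le> M" using M[of 0] norm_ge_zero[of "S 0"] by linarith
  have cont: "continuous_on I (\<lambda>\<tau>. f (S \<tau> y))" if "I \<subseteq> {0..}" for y I
    using continuous_on_subset[OF C0_semigroup_continuous_on[OF C0] that]
    by (rule bounded_linear.continuous_on[OF blinfun.bounded_linear_right])
  have int: "(\<lambda>\<tau>. f (S \<tau> y)) integrable_on {a..b}" if "0 \<le> a" for a b y
    using that by (intro integrable_continuous_interval cont) auto
  have bound: "\<bar>integral {a..b} (\<lambda>\<tau>. f (S \<tau> y))\<bar> \<le> (b - a) * M * norm y"
    if "0 \<le> a" "a \<le> b" "b \<le> 1" for a b y
  proof -
    have "norm (f (S \<tau> y)) \<le> M * norm y" if "\<tau> \<in> {a..b}" for \<tau>
    proof -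
      have "norm (f (S \<tau> y)) \<le> norm f * norm (S \<tau> y)" by (rule norm_blinfun)
      also have "\<dots> \<le> 1 * (norm (S \<tau>) * norm y)" using f(2) by (intro mult_mono norm_blinfun) auto
      also have "\<dots> \<le> M * norm y"
        using M[of \<tau>] that \<open>0 \<le> a\<close> \<open>b \<le> 1\<close> by (simp add: mult_right_mono)
      finally show ?thesis .
    qed
    then have "norm (integral {a..b} (\<lambda>\<tau>. f (S \<tau> y))) \<le> integral {a..b} (\<lambda>_. M * norm y)"
      using that by (intro integral_norm_bound_integral int) auto
    then show ?thesis using that by (simp add: ac_simps)
  qed
  have key: "norm x - \<epsilon> \<le> K * M" if "\<epsilon> > 0" for \<epsilon>
  proof -
    obtain d where d: "d > 0" "\<And>\<tau>. 0 \<le> \<tau> \<Longrightarrow> \<tau> < d \<Longrightarrow> \<bar>f (S \<tau> x) - norm x\<bar> < \<epsilon>"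
    proof -
      have "continuous (at 0 within {0..}) (\<lambda>\<tau>. f (S \<tau> x))"
        using cont[of "{0..}" x] by (simp add: continuous_on_eq_continuous_within)
      from this[unfolded continuous_within_eps_delta, rule_format, OF \<open>\<epsilon> > 0\<close>]
      obtain d where "d > 0" "\<And>\<tau>. \<tau> \<in> {0..} \<Longrightarrow> dist \<tau> 0 < d \<Longrightarrow> dist (f (S \<tau> x)) (f (S 0 x)) < \<epsilon>"
        by auto
      then show ?thesis
        using f(1) C0_semigroup_0[OF C0] by (intro that[of d]) (auto simp: dist_real_def)
    qed
    define t where "t = min (d / 2) (1 / 2)"
    have t: "0 < t" "t \<le> 1 / 2" "t < d" using d(1) by (auto simp: t_def)
    define Y where "Y y = integral {0..t} (\<lambda>\<tau>. f (S \<tau> y)) / t" for y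
    have Yb: "\<bar>Y y\<bar> \<le> M * norm y" for y
      using bound[of 0 t y] t by (simp add: Y_def field_simps)
    have bl: "bounded_linear Y"
    proof (rule bounded_linear_intro)
      fix y z
      show "Y (y + z) = Y y + Y z"
        by (simp add: Y_def blinfun.bilinear_simps integral_add[OF int int] add_divide_distrib)
      show "Y (r *\<^sub>R y) = r *\<^sub>R Y y" for r
        by (simp add: Y_def blinfun.bilinear_simps)
      show "norm (Y y) \<le> norm y * M" using Yb[of y] by (simp add: mult.commute)
    qed
    define y' where "y' = Blinfun Y"
    have y': "y' y = Y y" for y by (simp add: y'_def bounded_linear_Blinfun_apply[OF bl])
    have "norm y' \<le> M"
      using M0 Yb by (intro norm_blinfun_bound) (auto simp: y')
    moreover have "y' \<in> sun S"
    proof -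
      have incr: "norm ((y' o\<^sub>L S h) - y') \<le> 2 * M / t * h" if h: "0 < h" "h < 1 / 2" for h
      proof (rule norm_blinfun_bound)
        show "0 \<le> 2 * M / t * h" using M0 t h by simp
        fix y
        define g where "g \<tau> = f (S \<tau> y)" for \<tau>
        have "integral {0..t} (\<lambda>\<tau>. f (S \<tau> (S h y))) = integral {0..t} (g \<circ> (+) h)"
          using C0_semigroup_add[OF C0, of _ h] h
          by (intro integral_cong) (simp add: g_def add.commute)
        also have "\<dots> = integral {h..t + h} g" by (simp add: integral_shift_Icc_real)
        finally have "integral {0..t} (\<lambda>\<tau>. f (S \<tau> (S h y))) = integral {h..t + h} g" .
        moreover have "integral {0..h} g + integral {h..t + h} g = integral {0..t + h} g"
          using t h int[of 0 y "t + h"] by (intro Henstock_Kurzweil_Integration.integral_combine) (auto simp: g_def[abs_def])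
        moreover have "integral {0..t} g + integral {t..t + h} g = integral {0..t + h} g"
          using t h int[of 0 y "t + h"] by (intro Henstock_Kurzweil_Integration.integral_combine) (auto simp: g_def[abs_def])
        ultimately have "Y (S h y) - Y y = (integral {t..t + h} g - integral {0..h} g) / t"
          by (simp add: Y_def g_def[abs_def] diff_divide_distrib[symmetric])
        moreover have "\<bar>integral {t..t + h} g\<bar> \<le> h * M * norm y" "\<bar>integral {0..h} g\<bar> \<le> h * M * norm y"
          using bound[of t "t + h" y] bound[of 0 h y] t h by (auto simp: g_def[abs_def])
        ultimately have "\<bar>Y (S h y) - Y y\<bar> \<le> (h * M * norm y + h * M * norm y) / t"
          using t by (simp only: abs_divide abs_of_pos) (intro divide_right_mono; linarith)
        then show "norm (((y' o\<^sub>L S h) - y') y) \<le> 2 * M / t * h * norm y"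
          by (simp add: blinfun.bilinear_simps y' algebra_simps)
      qed
      have "\<forall>\<^sub>F h in at_right 0. h < (1 / 2 :: real)"
        by (intro order_tendstoD(2)[OF tendsto_ident_at]) simp
      with eventually_at_right_less[of 0]
      have "\<forall>\<^sub>F h in at_right 0. norm (norm ((y' o\<^sub>L S h) - y')) \<le> 2 * M / t * h"
        by eventually_elim (use incr in auto)
      moreover have "((\<lambda>h. 2 * M / t * h) \<longlongrightarrow> 0) (at_right 0)"
        by (rule tendsto_mult_right_zero) (rule tendsto_ident_at)
      ultimately show ?thesis unfolding sun_def by (simp add: Lim_null_comparison)
    qed
    ultimately have "y' x \<le> K * M"
      using K(2)[of y'] mult_left_mono[OF _ K(1), of "norm y'" M] by linarith
    moreover have "integral {0..t} (\<lambda>\<tau>. norm x - \<epsilon>) \<le> integral {0..t} (\<lambda>\<tau>. f (S \<tau> x))"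
    proof (intro integral_le int)
      fix \<tau> assume "\<tau> \<in> {0..t}"
      with d(2)[of \<tau>] t show "norm x - \<epsilon> \<le> f (S \<tau> x)" by auto
    qed auto
    then have "norm x - \<epsilon> \<le> y' x" using t by (simp add: y' Y_def field_simps)
    ultimately show ?thesis by simp
  qed
  show ?thesis by (rule field_le_epsilon) (use key in \<open>simp add: algebra_simps\<close>)
qed

section \<open>Functionals on the sun dual\<close>

lemma sun_star_apply_scaleR: "l \<in> sun_star S \<Longrightarrow> x' \<in> sun S \<Longrightarrow> l (c *\<^sub>R x') = c * l x'"
  by (simp add: sun_star_def)

lemma sun_star_apply_add:
  "l \<in> sun_star S \<Longrightarrow> x' \<in> sun S \<Longrightarrow> y' \<in> sun S \<Longrightarrow> l (x' + y') = l x' + l y'"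
  by (simp add: sun_star_def)

lemma sun_star_apply_diff:
  "l \<in> sun_star S \<Longrightarrow> x' \<in> sun S \<Longrightarrow> y' \<in> sun S \<Longrightarrow> l (x' - y') = l x' - l y'"
  using sun_star_apply_add[OF _ _ sun_scaleR[of y' S "-1"], of l x']
    sun_star_apply_scaleR[of l S y' "-1"] by simp

lemma sun_star_outside: "l \<in> sun_star S \<Longrightarrow> x' \<notin> sun S \<Longrightarrow> l x' = 0"
  by (simp add: sun_star_def)

lemma sun_star_bound:
  assumes l: "l \<in> sun_star S"
  shows "\<bar>l x'\<bar> \<le> sun_star_norm S l * norm x'"
proof (cases "x' \<in> sun S \<and> x' \<noteq> 0")
  case True
  then have "\<bar>l ((1 / norm x') *\<^sub>R x')\<bar> \<le> sun_star_norm S l"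
    by (intro sun_star_norm_upper l sun_scaleR) auto
  then show ?thesis
    using True sun_star_apply_scaleR[OF l, of x' "1 / norm x'"] by (simp add: abs_mult field_simps)
next
  case False
  moreover have "l 0 = 0" using sun_star_apply_scaleR[OF l sun_0, of 0] by simp
  ultimately show ?thesis
    using sun_star_outside[OF l] by (cases "x' = 0") (auto simp: sun_star_norm_nonneg[OF l])
qed

lemma sun_star_norm_bound:
  assumes "\<And>x'. x' \<in> sun S \<Longrightarrow> \<bar>l x'\<bar> \<le> K * norm x'" "0 \<le> K"
  shows "sun_star_norm S l \<le> K"
proof (rule sun_star_norm_leI)
  fix x' assume "x' \<in> sun S" "norm x' \<le> 1"
  with assms(1)[of x'] mult_left_mono[of "norm x'" 1 K] assms(2) show "\<bar>l x'\<bar> \<le> K" by simp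
qed

lemma sun_star_norm_uminus: "sun_star_norm S (\<lambda>x'. - l x') = sun_star_norm S l"
  by (simp add: sun_star_norm_def)

lemma sun_star_norm_minus_commute:
  "sun_star_norm S (\<lambda>x'. l x' - m x') = sun_star_norm S (\<lambda>x'. m x' - l x')"
  by (simp add: sun_star_norm_def abs_minus_commute)

lemma sun_star_norm_triangle:
  assumes "l \<in> sun_star S" "m \<in> sun_star S"
  shows "sun_star_norm S (\<lambda>x'. l x' + m x') \<le> sun_star_norm S l + sun_star_norm S m"
proof (rule sun_star_norm_leI)
  fix x' assume "x' \<in> sun S" "norm x' \<le> 1"
  then show "\<bar>l x' + m x'\<bar> \<le> sun_star_norm S l + sun_star_norm S m"
    using sun_star_norm_upper[OF assms(1), of x'] sun_star_norm_upper[OF assms(2), of x'] by linarith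
qed

lemma sun_star_norm_triangle_diff:
  assumes "l \<in> sun_star S" "m \<in> sun_star S"
  shows "sun_star_norm S l \<le> sun_star_norm S m + sun_star_norm S (\<lambda>x'. l x' - m x')"
  using sun_star_norm_triangle[OF assms(2) sun_star_diff[OF assms]] by simp

lemma topspace_sun_star_topology: "topspace (sun_star_topology S) = sun_star S"
  unfolding sun_star_topology_def
  by (rule Metric_space.topspace_mtopology[OF Metric_space_sun_star])

lemma atin_top_of_set: "t \<in> I \<Longrightarrow> atin (top_of_set I) t = at t within I"
  by (rule filter_eqI)
    (auto simp: atin_subtopology_within eventually_atin_within eventually_at_topological)

text \<open>
  The topology on \<open>sun_star S\<close> is that of a metric on a carrier set; this is its translation into limits of
  norms, which is the form in which continuity is used below.
\<close>

lemma continuous_map_sun_star_iff: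
  fixes f :: "'b::topological_space \<Rightarrow> 'a::banach dual_fun"
  shows "continuous_map (top_of_set I) (sun_star_topology S) f \<longleftrightarrow>
    (\<forall>t\<in>I. f t \<in> sun_star S) \<and>
    (\<forall>t\<in>I. ((\<lambda>s. sun_star_norm S (\<lambda>x'. f s x' - f t x')) \<longlongrightarrow> 0) (at t within I))"
proof -
  interpret Metric_space "sun_star S" "sun_star_dist S" by (rule Metric_space_sun_star)
  have ev: "\<forall>\<^sub>F s in at t within I. f s \<in> sun_star S" if "\<forall>t\<in>I. f t \<in> sun_star S" for t
    using that by (simp add: eventually_at_filter)
  have "continuous_map (top_of_set I) (sun_star_topology S) f \<longleftrightarrow>
      (\<forall>t\<in>I. limitin mtopology f (f t) (at t within I))"
    by (simp add: continuous_map_atin sun_star_topology_def atin_top_of_set)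
  also have "\<dots> \<longleftrightarrow> (\<forall>t\<in>I. f t \<in> sun_star S \<and> (\<forall>\<^sub>F s in at t within I. f s \<in> sun_star S) \<and>
      ((\<lambda>s. sun_star_dist S (f s) (f t)) \<longlongrightarrow> 0) (at t within I))"
    by (simp add: limitin_metric_dist_null)
  also have "\<dots> \<longleftrightarrow> (\<forall>t\<in>I. f t \<in> sun_star S) \<and>
      (\<forall>t\<in>I. ((\<lambda>s. sun_star_dist S (f s) (f t)) \<longlongrightarrow> 0) (at t within I))"
    using ev by blast
  also have "\<dots> \<longleftrightarrow> (\<forall>t\<in>I. f t \<in> sun_star S) \<and>
    (\<forall>t\<in>I. ((\<lambda>s. sun_star_norm S (\<lambda>x'. f s x' - f t x')) \<longlongrightarrow> 0) (at t within I))"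
  proof (intro conj_cong ball_cong refl)
    fix t assume I: "\<forall>t\<in>I. f t \<in> sun_star S" and t: "t \<in> I"
    show "((\<lambda>s. sun_star_dist S (f s) (f t)) \<longlongrightarrow> 0) (at t within I) \<longleftrightarrow>
        ((\<lambda>s. sun_star_norm S (\<lambda>x'. f s x' - f t x')) \<longlongrightarrow> 0) (at t within I)"
    proof (rule filterlim_cong)
      show "\<forall>\<^sub>F s in at t within I. sun_star_dist S (f s) (f t) = sun_star_norm S (\<lambda>x'. f s x' - f t x')"
        using ev[OF I] by eventually_elim (use I t in \<open>auto simp: sun_star_dist_def\<close>)
    qed auto
  qed
  finally show ?thesis .
qed

lemma sun_star_continuousI:
  fixes f :: "'b::topological_space \<Rightarrow> 'a::banach dual_fun"
  assumes f: "\<And>t. t \<in> I \<Longrightarrow> f t \<in> sun_star S"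
    and b: "\<And>s t. s \<in> I \<Longrightarrow> t \<in> I \<Longrightarrow> sun_star_norm S (\<lambda>x'. f s x' - f t x') \<le> b s t"
    and lim: "\<And>t. t \<in> I \<Longrightarrow> ((\<lambda>s. b s t) \<longlongrightarrow> 0) (at t within I)"
  shows "continuous_map (top_of_set I) (sun_star_topology S) f"
  unfolding continuous_map_sun_star_iff
proof (intro conjI ballI)
  fix t assume t: "t \<in> I"
  have "\<forall>\<^sub>F s in at t within I. norm (sun_star_norm S (\<lambda>x'. f s x' - f t x')) \<le> b s t"
    unfolding eventually_at_filter
    using b t sun_star_norm_nonneg[OF sun_star_diff[OF f f]] by (intro always_eventually) auto
  then show "((\<lambda>s. sun_star_norm S (\<lambda>x'. f s x' - f t x')) \<longlongrightarrow> 0) (at t within I)"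
    using lim[OF t] by (rule Lim_null_comparison)
qed (rule f)

lemma sun_star_continuous_diff:
  fixes f g :: "'b::topological_space \<Rightarrow> 'a::banach dual_fun"
  assumes f: "continuous_map (top_of_set I) (sun_star_topology S) f"
    and g: "continuous_map (top_of_set I) (sun_star_topology S) g"
  shows "continuous_map (top_of_set I) (sun_star_topology S) (\<lambda>t x'. f t x' - g t x')"
proof (rule sun_star_continuousI)
  fix s t assume st: "s \<in> I" "t \<in> I"
  have in_star: "f r \<in> sun_star S" "g r \<in> sun_star S" if "r \<in> I" for r
    using f g that by (auto simp: continuous_map_sun_star_iff)
  show "(\<lambda>x'. f t x' - g t x') \<in> sun_star S" using in_star st by (intro sun_star_diff)
  have "sun_star_norm S (\<lambda>x'. (f s x' - f t x') + (g t x' - g s x'))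
      \<le> sun_star_norm S (\<lambda>x'. f s x' - f t x') + sun_star_norm S (\<lambda>x'. g t x' - g s x')"
    using in_star st by (intro sun_star_norm_triangle sun_star_diff)
  then show "sun_star_norm S (\<lambda>x'. (f s x' - g s x') - (f t x' - g t x'))
      \<le> sun_star_norm S (\<lambda>x'. f s x' - f t x') + sun_star_norm S (\<lambda>x'. g s x' - g t x')"
    by (simp add: sun_star_norm_minus_commute[of S "g t"] algebra_simps)
next
  fix t assume "t \<in> I"
  then show "((\<lambda>s. sun_star_norm S (\<lambda>x'. f s x' - f t x') + sun_star_norm S (\<lambda>x'. g s x' - g t x'))
      \<longlongrightarrow> 0) (at t within I)"
    using f g by (intro tendsto_add_zero) (auto simp: continuous_map_sun_star_iff)
qed

lemma continuous_on_sun_star_norm: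
  fixes f :: "'b::topological_space \<Rightarrow> 'a::banach dual_fun"
  assumes f: "continuous_map (top_of_set I) (sun_star_topology S) f"
  shows "continuous_on I (\<lambda>t. sun_star_norm S (f t))"
proof -
  have in_star: "f r \<in> sun_star S" if "r \<in> I" for r
    using f that by (auto simp: continuous_map_sun_star_iff)
  have "((\<lambda>s. sun_star_norm S (f s)) \<longlongrightarrow> sun_star_norm S (f t)) (at t within I)" if t: "t \<in> I" for t
  proof -
    have "\<forall>\<^sub>F s in at t within I. norm (sun_star_norm S (f s) - sun_star_norm S (f t))
        \<le> sun_star_norm S (\<lambda>x'. f s x' - f t x')"
      unfolding eventually_at_filter
    proof (intro always_eventually allI impI)
      fix s assume "s \<in> I"
      then show "norm (sun_star_norm S (f s) - sun_star_norm S (f t))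
          \<le> sun_star_norm S (\<lambda>x'. f s x' - f t x')"
        using sun_star_norm_triangle_diff[OF in_star in_star, of s t]
          sun_star_norm_triangle_diff[OF in_star in_star, of t s]
          sun_star_norm_minus_commute[of S "f s" "f t"] t by (simp add: abs_le_iff)
    qed
    from Lim_null_comparison[OF this] show ?thesis
      using f t by (simp add: continuous_map_sun_star_iff Lim_null[of "\<lambda>s. sun_star_norm S (f s)"])
  qed
  then show ?thesis by (simp add: continuous_on_def)
qed

text \<open>
  The integrands of the weak-star integrals have this form, with \<open>c\<close> an adjoint orbit in the sun dual;
  so these integrals are integrals of continuous functions.
\<close>

lemma continuous_on_sun_star_pairing:
  fixes f :: "'b::topological_space \<Rightarrow> 'a::banach dual_fun"
  assumes f: "continuous_map (top_of_set I) (sun_star_topology S) f"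
    and c: "continuous_on I c" "\<And>t. t \<in> I \<Longrightarrow> c t \<in> sun S"
  shows "continuous_on I (\<lambda>t. f t (c t))"
  unfolding continuous_on_def
proof
  fix t assume t: "t \<in> I"
  have in_star: "f r \<in> sun_star S" if "r \<in> I" for r
    using f that by (auto simp: continuous_map_sun_star_iff)
  have c': "(c \<longlongrightarrow> c t) (at t within I)" using c(1) t by (simp add: continuous_on_def)
  define b where "b s = sun_star_norm S (\<lambda>x'. f s x' - f t x') * norm (c s) +
      sun_star_norm S (f t) * norm (c s - c t)" for s
  have "((\<lambda>s. sun_star_norm S (\<lambda>x'. f s x' - f t x')) \<longlongrightarrow> 0) (at t within I)"
    using f t by (simp add: continuous_map_sun_star_iff)
  from tendsto_mult[OF this tendsto_norm[OF c']]
  have lim: "(b \<longlongrightarrow> 0) (at t within I)"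
    unfolding b_def using c'
    by (intro tendsto_add_zero tendsto_mult_right_zero) (auto simp: tendsto_norm_zero_iff Lim_null[of c])
  have "\<forall>\<^sub>F s in at t within I. norm (f s (c s) - f t (c t)) \<le> b s"
    unfolding eventually_at_filter
  proof (intro always_eventually allI impI)
    fix s assume s: "s \<in> I"
    have "f s (c s) - f t (c t) = (f s (c s) - f t (c s)) + f t (c s - c t)"
      using sun_star_apply_diff[OF in_star, of t "c s" "c t"] s t c by simp
    moreover have "\<bar>f s (c s) - f t (c s)\<bar> \<le> sun_star_norm S (\<lambda>x'. f s x' - f t x') * norm (c s)"
      using sun_star_bound[OF sun_star_diff[OF in_star in_star], of s t "c s"] s t by simp
    moreover have "\<bar>f t (c s - c t)\<bar> \<le> sun_star_norm S (f t) * norm (c s - c t)"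
      by (rule sun_star_bound[OF in_star[OF t]])
    ultimately show "norm (f s (c s) - f t (c t)) \<le> b s" by (simp add: b_def)
  qed
  from Lim_null_comparison[OF this lim]
  show "((\<lambda>s. f s (c s)) \<longlongrightarrow> f t (c t)) (at t within I)"
    by (simp add: Lim_null[of "\<lambda>s. f s (c s)"])
qed

lemma sun_embed_inject:
  assumes C0: "C0_semigroup S"
  shows "inj (sun_embed S)"
proof (rule injI)
  fix x y assume eq: "sun_embed S x = sun_embed S y"
  obtain M where M: "\<And>t. 0 \<le> t \<Longrightarrow> t \<le> 1 \<Longrightarrow> norm (S t) \<le> M"
    using C0_semigroup_bounded[OF C0] by metis
  have "x' x = x' y" if "x' \<in> sun S" for x' using fun_cong[OF eq, of x'] that by (simp add: sun_embed_def)
  then have "norm (x - y) \<le> 0 * M"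
    by (intro norm_le_sun_bound[OF C0 M]) (auto simp: blinfun.bilinear_simps)
  then show "x = y" by simp
qed

section \<open>The weak-star convolution with the semigroup\<close>

text \<open>
  The weak-star integral of the variation-of-constants formula.
\<close>

abbreviation duhamel ::
    "(real \<Rightarrow> 'a::banach \<Rightarrow>\<^sub>L 'a) \<Rightarrow> (real \<Rightarrow> 'a dual_fun) \<Rightarrow> real \<Rightarrow> real \<Rightarrow> 'a dual_fun" where
  "duhamel S f s t \<equiv> weak_star_integral s t (\<lambda>\<tau>. sun_star_semigroup S (t - \<tau>) (f \<tau>))"

lemma duhamel_apply:
  "x' \<in> sun S \<Longrightarrow> duhamel S f s t x' = integral {s..t} (\<lambda>\<tau>. f \<tau> (x' o\<^sub>L S (t - \<tau>)))"
  by (simp add: weak_star_integral_def sun_star_semigroup_def)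

lemma duhamel_outside: "x' \<notin> sun S \<Longrightarrow> duhamel S f s t x' = 0"
  by (simp add: weak_star_integral_def sun_star_semigroup_def)

lemma duhamel_refl: "duhamel S f t t = sun_embed S 0"
  by (rule ext) (simp add: weak_star_integral_def sun_embed_def)

lemma duhamel_cong:
  assumes "\<And>\<tau>. \<tau> \<in> {s..t} \<Longrightarrow> f \<tau> = g \<tau>"
  shows "duhamel S f s t = duhamel S g s t"
  unfolding weak_star_integral_def using assms by (intro ext integral_cong) simp

lemma continuous_on_duhamel_integrand:
  assumes C0: "C0_semigroup S" and x': "x' \<in> sun S"
    and f: "continuous_map (top_of_set {s..t}) (sun_star_topology S) f" and r: "t \<le> r"
  shows "continuous_on {s..t} (\<lambda>\<tau>. f \<tau> (x' o\<^sub>L S (r - \<tau>)))"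
proof (rule continuous_on_sun_star_pairing[OF f])
  show "continuous_on {s..t} (\<lambda>\<tau>. x' o\<^sub>L S (r - \<tau>))"
    by (rule continuous_on_compose2[OF sun_orbit_continuous_on[OF C0 x']])
      (use r in \<open>auto intro!: continuous_intros\<close>)
  show "x' o\<^sub>L S (r - \<tau>) \<in> sun S" if "\<tau> \<in> {s..t}" for \<tau>
    using that r by (intro sun_adjoint C0 x') auto
qed

lemma integrable_duhamel_integrand:
  assumes "C0_semigroup S" "x' \<in> sun S"
    and "continuous_map (top_of_set {s..t}) (sun_star_topology S) f" "t \<le> r"
  shows "(\<lambda>\<tau>. f \<tau> (x' o\<^sub>L S (r - \<tau>))) integrable_on {s..t}"
  by (intro integrable_continuous_interval continuous_on_duhamel_integrand assms)

lemma duhamel_bound: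
  assumes C0: "C0_semigroup S"
    and M: "\<And>r. 0 \<le> r \<Longrightarrow> r \<le> t - s \<Longrightarrow> norm (S r) \<le> M"
    and f: "continuous_map (top_of_set {s..t}) (sun_star_topology S) f"
    and g: "continuous_on {s..t} g" "\<And>\<tau>. \<tau> \<in> {s..t} \<Longrightarrow> sun_star_norm S (f \<tau>) \<le> g \<tau>"
    and x': "x' \<in> sun S"
  shows "\<bar>duhamel S f s t x'\<bar> \<le> M * integral {s..t} g * norm x'"
proof -
  have in_star: "f \<tau> \<in> sun_star S" if "\<tau> \<in> {s..t}" for \<tau>
    using f that by (auto simp: continuous_map_sun_star_iff)
  have "norm (integral {s..t} (\<lambda>\<tau>. f \<tau> (x' o\<^sub>L S (t - \<tau>)))) \<le> integral {s..t} (\<lambda>\<tau>. g \<tau> * (M * norm x'))"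
  proof (rule integral_norm_bound_integral)
    show "(\<lambda>\<tau>. f \<tau> (x' o\<^sub>L S (t - \<tau>))) integrable_on {s..t}"
      by (rule integrable_duhamel_integrand[OF C0 x' f order.refl])
    show "(\<lambda>\<tau>. g \<tau> * (M * norm x')) integrable_on {s..t}"
      using g(1) by (intro integrable_continuous_interval continuous_intros)
    fix \<tau> assume \<tau>: "\<tau> \<in> {s..t}"
    have "\<bar>f \<tau> (x' o\<^sub>L S (t - \<tau>))\<bar> \<le> sun_star_norm S (f \<tau>) * norm (x' o\<^sub>L S (t - \<tau>))"
      by (rule sun_star_bound[OF in_star[OF \<tau>]])
    also have "\<dots> \<le> g \<tau> * (M * norm x')"
    proof (rule mult_mono)
      have "norm (x' o\<^sub>L S (t - \<tau>)) \<le> norm x' * norm (S (t - \<tau>))" by (rule norm_blinfun_compose)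
      also have "\<dots> \<le> norm x' * M" using M[of "t - \<tau>"] \<tau> by (intro mult_left_mono) auto
      finally show "norm (x' o\<^sub>L S (t - \<tau>)) \<le> M * norm x'" by (simp add: mult.commute)
      show "sun_star_norm S (f \<tau>) \<le> g \<tau>" by (rule g(2)[OF \<tau>])
      then show "0 \<le> g \<tau>" using sun_star_norm_nonneg[OF in_star[OF \<tau>]] by linarith
    qed simp
    finally show "norm (f \<tau> (x' o\<^sub>L S (t - \<tau>))) \<le> g \<tau> * (M * norm x')" by simp
  qed
  also have "\<dots> = M * integral {s..t} g * norm x'" by simp
  finally show ?thesis by (simp add: duhamel_apply[OF x'])
qed

lemma duhamel_diff:
  assumes C0: "C0_semigroup S" and x': "x' \<in> sun S"
    and f: "continuous_map (top_of_set {s..t}) (sun_star_topology S) f"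
    and g: "continuous_map (top_of_set {s..t}) (sun_star_topology S) g"
  shows "duhamel S (\<lambda>\<tau> x'. f \<tau> x' - g \<tau> x') s t x' = duhamel S f s t x' - duhamel S g s t x'"
  unfolding duhamel_apply[OF x']
  by (rule integral_diff) (rule integrable_duhamel_integrand[OF C0 x' _ order.refl], fact)+

text \<open>
  The adjoint semigroup maps \<open>j v\<close> to \<open>j (S (r - t) v)\<close>, so the part of the integral up to \<open>t\<close> is transported
  to time \<open>r\<close> inside \<open>X\<close>. Both the passage from short to long intervals and the continuity in time rest on
  this.
\<close>

lemma duhamel_split:
  assumes C0: "C0_semigroup S"
    and f: "continuous_map (top_of_set {s..r}) (sun_star_topology S) f" and "s \<le> t" "t \<le> r"
    and v: "duhamel S f s t = sun_embed S v"
  shows "duhamel S f s r x' = sun_embed S (S (r - t) v) x' + duhamel S f t r x'"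
proof (cases "x' \<in> sun S")
  case x': True
  define g where "g \<tau> = f \<tau> (x' o\<^sub>L S (r - \<tau>))" for \<tau>
  have "integral {s..t} g + integral {t..r} g = integral {s..r} g"
    unfolding g_def using assms(3,4) integrable_duhamel_integrand[OF C0 x' f order.refl]
    by (rule Henstock_Kurzweil_Integration.integral_combine)
  moreover have "integral {s..t} g = duhamel S f s t (x' o\<^sub>L S (r - t))"
    unfolding g_def duhamel_apply[OF sun_adjoint[OF C0 x' diff_ge_0_iff_ge[THEN iffD2, OF \<open>t \<le> r\<close>]]]
  proof (rule integral_cong)
    fix \<tau> assume "\<tau> \<in> {s..t}"
    then have "S (r - \<tau>) = S (r - t) o\<^sub>L S (t - \<tau>)"
      using C0_semigroup_add[OF C0, of "r - t" "t - \<tau>"] \<open>t \<le> r\<close> by simp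
    then show "f \<tau> (x' o\<^sub>L S (r - \<tau>)) = f \<tau> (x' o\<^sub>L S (r - t) o\<^sub>L S (t - \<tau>))"
      by (simp add: blinfun_compose_assoc)
  qed
  moreover have "duhamel S f s t (x' o\<^sub>L S (r - t)) = x' (S (r - t) v)"
    using sun_adjoint[OF C0 x', of "r - t"] \<open>t \<le> r\<close> by (simp add: v sun_embed_def)
  ultimately show ?thesis using x' by (simp add: duhamel_apply sun_embed_def g_def[abs_def])
qed (simp add: duhamel_outside sun_embed_def)

lemma sun_embed_add: "sun_embed S (x + y) = (\<lambda>x'. sun_embed S x x' + sun_embed S y x')"
  by (rule ext) (simp add: sun_embed_def blinfun.bilinear_simps)

text \<open>
  An interval that is no longer than \<open>[a, b]\<close> can be translated into \<open>J\<close>, because the integral depends only on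
  time differences. Clamping extends the translated function from a subinterval to all of \<open>J\<close>
  continuously and with the same values.
\<close>

lemma duhamel_in_range_short:
  assumes C0: "C0_semigroup S"
    and J: "is_interval J" "a \<in> J" "b \<in> J"
    and adm: "\<And>f s t. continuous_map (top_of_set J) (sun_star_topology S) f \<Longrightarrow> f ` J \<subseteq> Y \<Longrightarrow>
        s \<in> J \<Longrightarrow> t \<in> J \<Longrightarrow> s \<le> t \<Longrightarrow> duhamel S f s t \<in> range (sun_embed S)"
    and f: "continuous_map (top_of_set {s..t}) (sun_star_topology S) f" "f ` {s..t} \<subseteq> Y"
    and st: "s \<le> t" "t - s \<le> b - a"
  shows "duhamel S f s t \<in> range (sun_embed S)"
proof -
  define c where "c \<sigma> = max s (min t (\<sigma> + (s - a)))" for \<sigma>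
  have c: "c \<sigma> \<in> {s..t}" for \<sigma> using st by (auto simp: c_def)
  have "continuous_map (top_of_set J) (top_of_set {s..t}) c"
    using c by (auto simp: c_def[abs_def] intro!: continuous_intros)
  from continuous_map_compose[OF this f(1)]
  have g: "continuous_map (top_of_set J) (sun_star_topology S) (f \<circ> c)" .
  have "t - s + a \<in> J" using J(1)[unfolded is_interval_1, rule_format, OF J(2,3), of "t - s + a"] st by simp
  then have "duhamel S (f \<circ> c) a (t - s + a) \<in> range (sun_embed S)"
    using f(2) c J(2) st by (intro adm[OF g]) auto
  moreover have "duhamel S (f \<circ> c) a (t - s + a) = duhamel S f s t"
  proof
    fix x'
    show "duhamel S (f \<circ> c) a (t - s + a) x' = duhamel S f s t x'"
    proof (cases "x' \<in> sun S")
      case True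
      define F where "F \<sigma> = (f \<circ> c) \<sigma> (x' o\<^sub>L S (t - s + a - \<sigma>))" for \<sigma>
      have "integral {s..t} (\<lambda>\<tau>. f \<tau> (x' o\<^sub>L S (t - \<tau>))) = integral {s..t} (F \<circ> (+) (a - s))"
        by (rule integral_cong) (auto simp: F_def c_def algebra_simps)
      also have "\<dots> = integral {a..t - s + a} F"
        by (simp add: integral_shift_Icc_real algebra_simps)
      finally show ?thesis using True by (simp add: duhamel_apply F_def[abs_def])
    qed (simp add: duhamel_outside)
  qed
  ultimately show ?thesis by simp
qed

text \<open>
  A long interval is exhausted in steps of length at most \<open>\<beta> - \<alpha>\<close>, where \<open>\<alpha> < \<beta>\<close> are two points of the
  interval \<open>J\<close> from the definition of admissibility.
\<close>

theorem duhamel_in_range: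
  assumes C0: "C0_semigroup S" and adm: "admissible_range S Y"
    and f: "continuous_map (top_of_set {0..b}) (sun_star_topology S) f" "f ` {0..b} \<subseteq> Y"
    and t: "0 \<le> t" "t \<le> b"
  shows "duhamel S f 0 t \<in> range (sun_embed S)"
proof -
  obtain J where J0: "is_interval J" and ab: "\<exists>a\<in>J. \<exists>b\<in>J. a < b"
    and ad: "\<forall>f. continuous_map (top_of_set J) (sun_star_topology S) f \<and> f ` J \<subseteq> Y \<longrightarrow>
      (\<forall>s\<in>J. \<forall>t\<in>J. s \<le> t \<longrightarrow> duhamel S f s t \<in> range (sun_embed S))"
    using adm[unfolded admissible_range_def, THEN conjunct2] by (elim exE conjE) (rule that)
  obtain \<alpha> \<beta> where J: "is_interval J" "\<alpha> \<in> J" "\<beta> \<in> J" "\<alpha> < \<beta>" using J0 ab by blast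
  note adm = ad[rule_format, OF conjI]
  have "duhamel S f 0 t \<in> range (sun_embed S)"
    if "0 \<le> t" "t \<le> b" "t \<le> real n * (\<beta> - \<alpha>)" for n t
    using that
  proof (induction n arbitrary: t)
    case 0
    then have "t = 0" by simp
    show ?case unfolding \<open>t = 0\<close> duhamel_refl by (rule rangeI)
  next
    case (Suc n)
    define r where "r = max 0 (t - (\<beta> - \<alpha>))"
    have r: "0 \<le> r" "r \<le> t" "t - r \<le> \<beta> - \<alpha>" "r \<le> real n * (\<beta> - \<alpha>)"
      using Suc.prems J(4) mult_nonneg_nonneg[of "real n" "\<beta> - \<alpha>"]
      by (auto simp: r_def distrib_right)
    obtain v where v: "duhamel S f 0 r = sun_embed S v"
      using Suc.IH[of r] r Suc.prems by auto
    have cont: "continuous_map (top_of_set I) (sun_star_topology S) f" if "I \<subseteq> {0..b}" for I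
      using f(1) that by (rule continuous_map_from_subtopology_mono)
    have "duhamel S f r t \<in> range (sun_embed S)"
      using r Suc.prems f(2)
      by (intro duhamel_in_range_short[OF C0 J(1,2,3) adm] cont) auto
    then obtain w where w: "duhamel S f r t = sun_embed S w" by blast
    have "duhamel S f 0 t = sun_embed S (S (t - r) v + w)"
      using duhamel_split[OF C0 cont r(1,2) v] Suc.prems w
      by (intro ext) (simp add: sun_embed_add)
    then show ?case by blast
  qed
  moreover obtain n :: nat where "t / (\<beta> - \<alpha>) \<le> real n" using real_arch_simple by blast
  then have "t \<le> real n * (\<beta> - \<alpha>)" using J(4) by (simp add: field_simps)
  ultimately show ?thesis using t by blast
qed

text \<open>
  For \<open>r\<close> slightly above a fixed \<open>s\<close>, the value \<open>v r\<close> differs from the continuous orbit \<open>S (r - s) (v s)\<close> by at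
  most a multiple of \<open>r - s\<close>. Choosing \<open>s\<close> slightly before \<open>t\<close> gives continuity at \<open>t\<close> from both sides.
\<close>

lemma continuous_on_duhamel:
  assumes C0: "C0_semigroup S"
    and f: "continuous_map (top_of_set {0..b}) (sun_star_topology S) f"
    and v: "\<And>t. t \<in> {0..b} \<Longrightarrow> duhamel S f 0 t = sun_embed S (v t)"
  shows "continuous_on {0..b} v"
proof (cases "0 \<le> b")
  case b: True
  obtain M where M: "1 \<le> M" "\<And>t. 0 \<le> t \<Longrightarrow> t \<le> max b 1 \<Longrightarrow> norm (S t) \<le> M"
    using C0_semigroup_bounded[OF C0] by metis
  have in_star: "f \<tau> \<in> sun_star S" if "\<tau> \<in> {0..b}" for \<tau>
    using f that by (auto simp: continuous_map_sun_star_iff)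
  obtain B where B: "\<And>\<tau>. \<tau> \<in> {0..b} \<Longrightarrow> sun_star_norm S (f \<tau>) \<le> B"
  proof -
    have "compact ((\<lambda>\<tau>. sun_star_norm S (f \<tau>)) ` {0..b})"
      by (intro compact_continuous_image continuous_on_sun_star_norm[OF f] compact_Icc)
    then have "bounded ((\<lambda>\<tau>. sun_star_norm S (f \<tau>)) ` {0..b})" by (rule compact_imp_bounded)
    then obtain B where "\<And>\<tau>. \<tau> \<in> {0..b} \<Longrightarrow> \<bar>sun_star_norm S (f \<tau>)\<bar> \<le> B"
      by (meson bounded_real imageI)
    then have "\<And>\<tau>. \<tau> \<in> {0..b} \<Longrightarrow> sun_star_norm S (f \<tau>) \<le> B" by (meson abs_le_D1)
    then show ?thesis by (rule that)
  qed
  have B0: "0 \<le> B" using B[of 0] sun_star_norm_nonneg[OF in_star[of 0]] b by simp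
  define D where "D = M * B * M"
  have D0: "0 \<le> D" using M(1) B0 by (simp add: D_def)
  have cont: "continuous_map (top_of_set I) (sun_star_topology S) f" if "I \<subseteq> {0..b}" for I
    using f that by (rule continuous_map_from_subtopology_mono)
  have step: "norm (v r - S (r - s) (v s)) \<le> D * (r - s)" if "0 \<le> s" "s \<le> r" "r \<le> b" for r s
  proof -
    have vs: "duhamel S f 0 s = sun_embed S (v s)" using that v by auto
    have "norm (v r - S (r - s) (v s)) \<le> M * (B * (r - s)) * M"
    proof (rule norm_le_sun_bound[OF C0])
      fix x' assume x': "x' \<in> sun S"
      have "x' (v r - S (r - s) (v s)) = duhamel S f s r x'"
        using duhamel_split[OF C0 cont that(1,2) vs, of x'] v[of r] x' that
        by (simp add: sun_embed_def blinfun.bilinear_simps)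
      also have "\<bar>\<dots>\<bar> \<le> M * integral {s..r} (\<lambda>_. B) * norm x'"
        using M(2) B that by (intro duhamel_bound[OF C0 _ cont _ _ x']) auto
      finally show "\<bar>x' (v r - S (r - s) (v s))\<bar> \<le> M * (B * (r - s)) * norm x'"
        using that by (simp add: mult.commute)
    qed (use M B0 that in auto)
    then show ?thesis by (simp add: D_def algebra_simps)
  qed
  have "continuous (at t within {0..b}) v" if t: "t \<in> {0..b}" for t
    unfolding continuous_within_eps_delta
  proof (intro allI impI)
    fix \<epsilon> :: real assume \<epsilon>: "0 < \<epsilon>"
    \<comment> \<open>The three error terms below are each less than \<open>\<epsilon> / 3\<close>; two of them involve a time span of at most \<open>2 * \<eta>\<close>.\<close>
    define \<eta> where "\<eta> = \<epsilon> / (6 * (D + 1))"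
    have \<eta>: "0 < \<eta>" using \<epsilon> D0 by (simp add: \<eta>_def)
    define s where "s = max 0 (t - \<eta>)"
    have s: "0 \<le> s" "s \<le> t" "t - s \<le> \<eta>" using t \<eta> by (auto simp: s_def)
    have "continuous (at (t - s) within {0..}) (\<lambda>r. S r (v s))"
      using C0_semigroup_continuous_on[OF C0, of "v s"] s by (simp add: continuous_on_eq_continuous_within)
    then obtain \<delta> where \<delta>: "\<delta> > 0" "\<And>r. 0 \<le> r \<Longrightarrow> \<bar>r - (t - s)\<bar> < \<delta> \<Longrightarrow>
        norm (S r (v s) - S (t - s) (v s)) < \<epsilon> / 3"
      unfolding continuous_within_eps_delta using \<epsilon>
      by (auto simp: dist_norm dest!: spec[of _ "\<epsilon> / 3"])
    have small: "D * (r - s) < \<epsilon> / 3" if "r - s \<le> 2 * \<eta>" for r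
    proof -
      have "D * (r - s) \<le> D * (2 * \<eta>)" using that D0 by (rule mult_left_mono)
      also have "\<dots> < (D + 1) * (2 * \<eta>)" using \<eta> by simp
      also have "\<dots> = \<epsilon> / 3" using D0 by (simp add: \<eta>_def field_simps)
      finally show ?thesis .
    qed
    have "dist (v r) (v t) < \<epsilon>" if r: "r \<in> {0..b}" "dist r t < min \<delta> \<eta>" for r
    proof -
      have rs: "s \<le> r" "r - s \<le> 2 * \<eta>" using r s by (auto simp: dist_real_def s_def)
      have "norm (v r - S (r - s) (v s)) < \<epsilon> / 3" "norm (v t - S (t - s) (v s)) < \<epsilon> / 3"
        using step[of s r] step[of s t] small[of r] small[of t] rs s r(1) t \<eta> by auto
      moreover have "norm (S (r - s) (v s) - S (t - s) (v s)) < \<epsilon> / 3"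
        using \<delta>(2)[of "r - s"] rs r by (auto simp: dist_real_def)
      moreover have eq: "v r - v t = (v r - S (r - s) (v s)) + (S (r - s) (v s) - S (t - s) (v s))
          - (v t - S (t - s) (v s))" by simp
      ultimately show ?thesis
        using norm_triangle_ineq4[of "(v r - S (r - s) (v s)) + (S (r - s) (v s) - S (t - s) (v s))"
            "v t - S (t - s) (v s)"]
          norm_triangle_ineq[of "v r - S (r - s) (v s)" "S (r - s) (v s) - S (t - s) (v s)"]
        unfolding dist_norm eq by linarith
    qed
    then show "\<exists>\<delta>>0. \<forall>r\<in>{0..b}. dist r t < \<delta> \<longrightarrow> dist (v r) (v t) < \<epsilon>"
      using \<delta>(1) \<eta> by (intro exI[of _ "min \<delta> \<eta>"]) auto
  qed
  then show ?thesis by (simp add: continuous_on_eq_continuous_within)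
qed simp

section \<open>Continuously differentiable maps are locally Lipschitz\<close>

lemma multilinear_norm_0: "multilinear_norm S 0 M = sun_star_norm S (M [])"
proof -
  have "{vs. length vs = 0 \<and> (\<forall>v\<in>set vs. norm v \<le> 1)} = {[] :: 'a list}" by auto
  then show ?thesis by (simp add: multilinear_norm_def)
qed

lemma multilinear_norm_1_upper:
  assumes "\<And>v. norm v \<le> 1 \<Longrightarrow> sun_star_norm S (M [v]) \<le> C" and v: "norm v \<le> 1"
  shows "sun_star_norm S (M [v]) \<le> multilinear_norm S 1 M"
proof -
  let ?A = "{vs. length vs = 1 \<and> (\<forall>v\<in>set vs. norm v \<le> 1)}"
  have "sun_star_norm S (M vs) \<le> C" if "vs \<in> ?A" for vs
    using that assms(1) by (auto simp: length_Suc_conv)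
  then have "bdd_above ((\<lambda>vs. sun_star_norm S (M vs)) ` ?A)" by (rule bdd_aboveI2)
  then show ?thesis unfolding multilinear_norm_def using v by (intro cSUP_upper) auto
qed

lemma bounded_multilinear_1:
  assumes "bounded_multilinear S 1 A"
  obtains C where "0 \<le> C" "\<And>v. A [v] \<in> sun_star S" "\<And>x'. linear (\<lambda>v. A [v] x')"
    "\<And>v. sun_star_norm S (A [v]) \<le> C * norm v"
proof -
  obtain C where C: "\<And>vs. length vs = 1 \<Longrightarrow> sun_star_norm S (A vs) \<le> C * (\<Prod>v\<leftarrow>vs. norm v)"
    using assms unfolding bounded_multilinear_def by blast
  have "sun_star_norm S (A [v]) \<le> \<bar>C\<bar> * norm v" for v
    using C[of "[v]"] mult_right_mono[OF abs_ge_self, of "norm v" C] by simp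
  moreover have "A [v] \<in> sun_star S" for v
    using assms unfolding bounded_multilinear_def by simp
  moreover have "linear (\<lambda>v. A [v] x')" for x'
  proof -
    have "linear (\<lambda>v. A ([0][0 := v]) x')"
      using assms[unfolded bounded_multilinear_def, THEN conjunct2, THEN conjunct1, rule_format, of "[0]" 0 x']
      by simp
    then show ?thesis by simp
  qed
  ultimately show ?thesis using that[of "\<bar>C\<bar>"] by simp
qed

text \<open>
  A linear map that is at distance at most \<open>1\<close> from \<open>B + Q\<close> in operator norm is bounded by the bounds of \<open>B\<close>
  and \<open>Q\<close>. The qualitative boundedness of \<open>A\<close> and \<open>B\<close> ensures that the supremum in the operator norm is
  taken over a bounded set, so that it does bound the individual values.
\<close>

lemma multilinear_1_bound_transfer:
  assumes A: "bounded_multilinear S 1 A" and B: "bounded_multilinear S 1 B"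
    and C: "\<And>v. sun_star_norm S (B [v]) \<le> C * norm v" "0 \<le> C"
    and Q: "\<And>v. norm v \<le> 1 \<Longrightarrow> Q [v] \<in> sun_star S"
      "\<And>v. norm v \<le> 1 \<Longrightarrow> sun_star_norm S (Q [v]) \<le> q"
    and near: "multilinear_norm S 1 (\<lambda>vs x'. A vs x' - B vs x' - Q vs x') \<le> 1"
  shows "sun_star_norm S (A [v]) \<le> (1 + C + q) * norm v"
proof -
  obtain CA where CA: "0 \<le> CA" "\<And>v. A [v] \<in> sun_star S" "\<And>x'. linear (\<lambda>v. A [v] x')"
    "\<And>v. sun_star_norm S (A [v]) \<le> CA * norm v" using bounded_multilinear_1[OF A] by metis
  have B': "B [v] \<in> sun_star S" for v using bounded_multilinear_1[OF B] by metis
  have diff: "sun_star_norm S (\<lambda>x'. l x' - m x') \<le> sun_star_norm S l + sun_star_norm S m"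
    if "l \<in> sun_star S" "m \<in> sun_star S" for l m
    using sun_star_norm_triangle_diff[OF sun_star_diff[OF that] that(1)]
    by (simp add: sun_star_norm_uminus)
  have unit: "sun_star_norm S (A [v]) \<le> 1 + C + q" if v: "norm v \<le> 1" for v
  proof -
    have le: "CA * norm v \<le> CA" "C * norm v \<le> C" if "norm v \<le> 1" for v :: 'a
      using that CA(1) C(2) by (auto simp: mult_left_le)
    have bdd: "sun_star_norm S (\<lambda>x'. A [v] x' - B [v] x' - Q [v] x') \<le> CA + C + q"
      if v: "norm v \<le> 1" for v
      using diff[OF sun_star_diff[OF CA(2) B'] Q(1)[OF v], of v v] diff[OF CA(2) B', of v v]
        CA(4)[of v] C(1)[of v] Q(2)[OF v] le[OF v] by linarith
    have "sun_star_norm S (\<lambda>x'. A [v] x' - B [v] x' - Q [v] x') \<le> 1"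
      using multilinear_norm_1_upper[of S "\<lambda>vs x'. A vs x' - B vs x' - Q vs x'", OF bdd v] near by simp
    then show ?thesis
      using sun_star_norm_triangle_diff[OF sun_star_diff[OF CA(2) B'] Q(1)[OF v], of v v]
        sun_star_norm_triangle_diff[OF CA(2) B', of v v] C(1)[of v] Q(2)[OF v] le(2)[OF v]
      by linarith
  qed
  show ?thesis
  proof (cases "v = 0")
    case True
    then show ?thesis using CA(4)[of 0] by simp
  next
    case False
    define w where "w = (1 / norm v) *\<^sub>R v"
    have w: "norm w \<le> 1" "v = norm v *\<^sub>R w" using False by (simp_all add: w_def)
    have "0 \<le> 1 + C + q" using unit[OF w(1)] sun_star_norm_nonneg[OF CA(2), of w] by linarith
    moreover have "\<bar>A [v] x'\<bar> \<le> (1 + C + q) * norm v * norm x'" for x'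
    proof -
      have "A [v] x' = norm v * A [w] x'"
        using linear_scale[OF CA(3), of "norm v" w x'] w(2) by simp
      moreover have "\<bar>A [w] x'\<bar> \<le> (1 + C + q) * norm x'"
        using sun_star_bound[OF CA(2), of w x'] mult_right_mono[OF unit[OF w(1)], of "norm x'"] by simp
      ultimately show ?thesis
        using mult_left_mono[of "\<bar>A [w] x'\<bar>" "(1 + C + q) * norm x'" "norm v"]
        by (simp add: abs_mult algebra_simps)
    qed
    ultimately show ?thesis by (intro sun_star_norm_bound) auto
  qed
qed

text \<open>
  For \<open>k = 1\<close> the derivative is continuous by definition. For \<open>k > 1\<close> it is differentiable, so near \<open>x\<close> it
  differs little from its value at \<open>x\<close> plus the second derivative applied to the increment; \<open>Q\<close> is that
  second term, and zero in the first case.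
\<close>

lemma Ck_derivative_locally_bounded:
  fixes D :: "nat \<Rightarrow> 'a::banach \<Rightarrow> 'a list \<Rightarrow> 'a dual_fun"
  assumes k: "1 \<le> k"
    and ml: "\<forall>n\<le>k. \<forall>x. bounded_multilinear S n (D n x)"
    and der: "\<forall>n<k. \<forall>x. ((\<lambda>h. multilinear_norm S n
        (\<lambda>vs x'. D n (x + h) vs x' - D n x vs x' - D (Suc n) x (h # vs) x') / norm h) \<longlongrightarrow> 0) (at 0)"
    and cont: "\<forall>x. ((\<lambda>y. multilinear_norm S k (\<lambda>vs x'. D k y vs x' - D k x vs x')) \<longlongrightarrow> 0) (at x)"
  obtains r l where "0 < r" "0 \<le> l"
    "\<And>y v. y \<in> cball x r \<Longrightarrow> sun_star_norm S (D 1 y [v]) \<le> l * norm v"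
proof -
  have ml1: "bounded_multilinear S 1 (D 1 y)" for y using ml k by blast
  obtain C where C: "0 \<le> C" "\<And>v. D 1 x [v] \<in> sun_star S"
    "\<And>v. sun_star_norm S (D 1 x [v]) \<le> C * norm v" using bounded_multilinear_1[OF ml1] by metis
  obtain Q :: "'a \<Rightarrow> 'a list \<Rightarrow> 'a dual_fun" and q d where d: "0 < d" "d \<le> 1" and q: "0 \<le> q"
    and Q: "\<And>h v. norm h \<le> 1 \<Longrightarrow> norm v \<le> 1 \<Longrightarrow> Q h [v] \<in> sun_star S"
      "\<And>h v. norm h \<le> 1 \<Longrightarrow> norm v \<le> 1 \<Longrightarrow> sun_star_norm S (Q h [v]) \<le> q"
    and near: "\<And>h. h \<noteq> 0 \<Longrightarrow> norm h < d \<Longrightarrow>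
      multilinear_norm S 1 (\<lambda>vs x'. D 1 (x + h) vs x' - D 1 x vs x' - Q h vs x') \<le> 1"
  proof (cases "k = 1")
    case True
    have "\<forall>\<^sub>F y in at x. multilinear_norm S 1 (\<lambda>vs x'. D 1 y vs x' - D 1 x vs x') < 1"
      using order_tendstoD(2)[OF cont[rule_format, of x], of 1] True by simp
    then obtain d where d: "d > 0" "\<And>y. y \<noteq> x \<Longrightarrow> dist y x < d \<Longrightarrow>
        multilinear_norm S 1 (\<lambda>vs x'. D 1 y vs x' - D 1 x vs x') < 1"
      by (auto simp: eventually_at)
    have zero: "(\<lambda>x'. 0) \<in> sun_star S" using sun_star_diff[OF C(2)[of 0] C(2)[of 0]] by simp
    show ?thesis
    proof (rule that[of "min d 1" 0 "\<lambda>h vs x'. 0"])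
      show "multilinear_norm S 1 (\<lambda>vs x'. D 1 (x + h) vs x' - D 1 x vs x' - 0) \<le> 1"
        if "h \<noteq> 0" "norm h < min d 1" for h
        using d(2)[of "x + h"] that by (simp add: dist_norm)
      show "sun_star_norm S (\<lambda>x'. 0) \<le> 0" by (rule sun_star_norm_leI) simp
    qed (use d zero in auto)
  next
    case False
    then have k2: "1 < k" using k by simp
    then have ml2: "bounded_multilinear S 2 (D 2 x)" using ml by simp
    then obtain C2 where C2: "\<And>vs. length vs = 2 \<Longrightarrow> sun_star_norm S (D 2 x vs) \<le> C2 * (\<Prod>v\<leftarrow>vs. norm v)"
      unfolding bounded_multilinear_def by blast
    have "\<forall>\<^sub>F h in at 0. multilinear_norm S 1
        (\<lambda>vs x'. D 1 (x + h) vs x' - D 1 x vs x' - D (Suc 1) x (h # vs) x') / norm h < 1"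
      using der[rule_format, OF k2, of x] by (rule order_tendstoD(2)) simp
    then obtain d where d: "d > 0" "\<And>h. h \<noteq> 0 \<Longrightarrow> norm h < d \<Longrightarrow> multilinear_norm S 1
        (\<lambda>vs x'. D 1 (x + h) vs x' - D 1 x vs x' - D (Suc 1) x (h # vs) x') / norm h < 1"
      by (auto simp: eventually_at)
    show ?thesis
    proof (rule that[of "min d 1" "\<bar>C2\<bar>" "\<lambda>h vs. D (Suc 1) x (h # vs)"])
      fix h v :: 'a assume h: "norm h \<le> 1" and v: "norm v \<le> 1"
      show "D (Suc 1) x (h # [v]) \<in> sun_star S"
        using ml2 unfolding bounded_multilinear_def by (simp add: numeral_2_eq_2)
      have "sun_star_norm S (D 2 x [h, v]) \<le> C2 * (norm h * norm v)" using C2[of "[h, v]"] by simp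
      also have "\<dots> \<le> \<bar>C2\<bar> * (1 * 1)" using h v by (intro mult_mono) auto
      finally show "sun_star_norm S (D (Suc 1) x (h # [v])) \<le> \<bar>C2\<bar>" by (simp add: numeral_2_eq_2)
    next
      fix h :: 'a assume h: "h \<noteq> 0" "norm h < min d 1"
      then have "multilinear_norm S 1
        (\<lambda>vs x'. D 1 (x + h) vs x' - D 1 x vs x' - D (Suc 1) x (h # vs) x') < norm h"
        using d(2)[of h] by (simp add: divide_less_eq)
      with h show "multilinear_norm S 1
        (\<lambda>vs x'. D 1 (x + h) vs x' - D 1 x vs x' - D (Suc 1) x (h # vs) x') \<le> 1" by simp
    qed (use d in auto)
  qed
  have "sun_star_norm S (D 1 y [v]) \<le> (1 + C + q) * norm v" if y: "y \<in> cball x (d / 2)" for y v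
  proof (cases "y = x")
    case True
    have "C * norm v \<le> (1 + C + q) * norm v" using q by (intro mult_right_mono) auto
    then show ?thesis using order.trans[OF C(3)] True by blast
  next
    case False
    define h where "h = y - x"
    have h: "h \<noteq> 0" "norm h < d" "y = x + h"
      using False y d by (auto simp: h_def dist_norm norm_minus_commute)
    have "sun_star_norm S (D 1 (x + h) [v]) \<le> (1 + C + q) * norm v"
      using h d by (intro multilinear_1_bound_transfer[OF ml1 ml1 C(3,1) Q near]) auto
    then show ?thesis using h by simp
  qed
  then show ?thesis using that[of "d / 2" "1 + C + q"] d C(1) q by simp
qed

definition locally_lipschitz_sun_star ::
    "(real \<Rightarrow> 'a::banach \<Rightarrow>\<^sub>L 'a) \<Rightarrow> ('a \<Rightarrow> 'a dual_fun) \<Rightarrow> bool" where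
  "locally_lipschitz_sun_star S G \<longleftrightarrow>
     (\<forall>x. \<exists>r>0. \<exists>l\<ge>0. \<forall>y\<in>cball x r. \<forall>z\<in>cball x r.
        sun_star_norm S (\<lambda>x'. G y x' - G z x') \<le> l * norm (y - z))"

text \<open>
  The mean value inequality is applied to the scalar functions \<open>\<lambda>y. G y x'\<close>, with constants that are
  uniform in \<open>x'\<close>.
\<close>

theorem Ck_locally_lipschitz:
  assumes "Ck_sun_star S k G" and k: "1 \<le> k"
  shows "locally_lipschitz_sun_star S G"
  unfolding locally_lipschitz_sun_star_def
proof
  fix x
  obtain D :: "nat \<Rightarrow> 'a \<Rightarrow> 'a list \<Rightarrow> 'a dual_fun" where D0: "\<forall>x. D 0 x [] = G x"
    and ml: "\<forall>n\<le>k. \<forall>x. bounded_multilinear S n (D n x)"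
    and der: "\<forall>n<k. \<forall>x. ((\<lambda>h. multilinear_norm S n
        (\<lambda>vs x'. D n (x + h) vs x' - D n x vs x' - D (Suc n) x (h # vs) x') / norm h) \<longlongrightarrow> 0) (at 0)"
    and cont: "\<forall>x. ((\<lambda>y. multilinear_norm S k (\<lambda>vs x'. D k y vs x' - D k x vs x')) \<longlongrightarrow> 0) (at x)"
    using assms(1) unfolding Ck_sun_star_def by (elim exE conjE) (rule that)
  have Gs: "G y \<in> sun_star S" for y
    using ml D0 unfolding bounded_multilinear_def by (metis le0 list.size(3))
  have D1: "\<And>v. D 1 y [v] \<in> sun_star S" "\<And>x'. linear (\<lambda>v. D 1 y [v] x')" for y
    using bounded_multilinear_1[of S "D 1 y"] ml k by metis+
  obtain r l where r: "0 < r" "0 \<le> l"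
    and bound: "\<And>y v. y \<in> cball x r \<Longrightarrow> sun_star_norm S (D 1 y [v]) \<le> l * norm v"
    using Ck_derivative_locally_bounded[OF k ml der cont] by metis
  have op: "\<bar>D 1 p [h] x'\<bar> \<le> l * norm x' * norm h" if "p \<in> cball x r" for p h x'
    using sun_star_bound[OF D1(1), of p h x']
      mult_right_mono[OF bound[OF that, of h], of "norm x'"] by (simp add: algebra_simps)
  have deriv: "((\<lambda>y. G y x') has_derivative (\<lambda>h. D 1 p [h] x')) (at p)"
    if p: "p \<in> cball x r" for p x'
    unfolding has_derivative_at
  proof
    show "bounded_linear (\<lambda>h. D 1 p [h] x')"
      using D1(2)[of p x'] op[OF p, of _ x']
      by (intro bounded_linear_intro[where K = "l * norm x'"])
        (auto simp: linear_iff mult.commute)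
    have "((\<lambda>h. sun_star_norm S (\<lambda>x'. G (p + h) x' - G p x' - D 1 p [h] x') / norm h) \<longlongrightarrow> 0) (at 0)"
      using der[rule_format, of 0 p] k D0 by (simp add: multilinear_norm_0)
    then have lim: "((\<lambda>h. sun_star_norm S (\<lambda>x'. G (p + h) x' - G p x' - D 1 p [h] x') / norm h * norm x')
        \<longlongrightarrow> 0) (at 0)"
      by (rule tendsto_mult_left_zero)
    have "norm (norm (G (p + h) x' - G p x' - D 1 p [h] x') / norm h)
        \<le> sun_star_norm S (\<lambda>x'. G (p + h) x' - G p x' - D 1 p [h] x') / norm h * norm x'" for h
    proof -
      have "(\<lambda>x'. G (p + h) x' - G p x' - D 1 p [h] x') \<in> sun_star S"
        by (intro sun_star_diff Gs D1(1))
      from sun_star_bound[OF this, of x'] show ?thesis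
        by (simp add: divide_right_mono)
    qed
    then show "((\<lambda>h. norm (G (p + h) x' - G p x' - D 1 p [h] x') / norm h) \<longlongrightarrow> 0) (at 0)"
      by (intro Lim_null_comparison[OF always_eventually lim]) simp
  qed
  have "sun_star_norm S (\<lambda>x'. G y x' - G z x') \<le> l * norm (y - z)"
    if "y \<in> cball x r" "z \<in> cball x r" for y z
  proof (rule sun_star_norm_bound)
    fix x' assume "x' \<in> sun S"
    have "norm (G y x' - G z x') \<le> (l * norm x') * norm (y - z)"
    proof (rule differentiable_bound[OF convex_cball])
      show "((\<lambda>y. G y x') has_derivative (\<lambda>h. D 1 p [h] x')) (at p within cball x r)"
        if "p \<in> cball x r" for p
        using deriv[OF that] by (rule has_derivative_at_withinI)
      show "onorm (\<lambda>h. D 1 p [h] x') \<le> l * norm x'" if "p \<in> cball x r" for p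
        using op[OF that] r by (intro onorm_bound) auto
    qed (use that in auto)
    then show "\<bar>G y x' - G z x'\<bar> \<le> l * norm (y - z) * norm x'" by (simp add: algebra_simps)
  qed (use r in simp)
  then show "\<exists>r>0. \<exists>l\<ge>0. \<forall>y\<in>cball x r. \<forall>z\<in>cball x r.
      sun_star_norm S (\<lambda>x'. G y x' - G z x') \<le> l * norm (y - z)"
    using r by blast
qed

section \<open>A Gronwall estimate\<close>

lemma integral_exp_le:
  fixes c t :: real
  assumes "0 < c" "0 \<le> t"
  shows "integral {0..t} (\<lambda>\<tau>. exp (c * \<tau>)) \<le> exp (c * t) / c"
proof -
  have "((\<lambda>\<tau>. exp (c * \<tau>)) has_integral (exp (c * t) / c - exp (c * 0) / c)) {0..t}"
    using assms
    by (intro fundamental_theorem_of_calculus[where f = "\<lambda>\<tau>. exp (c * \<tau>) / c"])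
      (auto intro!: derivative_eq_intros simp: has_real_derivative_iff_has_vector_derivative[symmetric])
  then show ?thesis using assms by (simp add: integral_unique)
qed

text \<open>
  At the point \<open>s\<close> where \<open>exp (- 2 c t) * v t\<close> is largest, the integral term amounts to at most half of that
  maximum, so it can be absorbed into the left-hand side.
\<close>

lemma gronwall:
  fixes v :: "real \<Rightarrow> real"
  assumes v: "continuous_on {0..b} v" and "0 \<le> a" "0 < c"
    and le: "\<And>t. t \<in> {0..b} \<Longrightarrow> v t \<le> a + c * integral {0..t} v"
    and t: "t \<in> {0..b}"
  shows "v t \<le> 2 * a * exp (2 * c * t)"
proof -
  have "continuous_on {0..b} (\<lambda>\<tau>. exp (- (2 * c * \<tau>)) * v \<tau>)"
    using v by (intro continuous_intros)
  then obtain s where s: "s \<in> {0..b}"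
    and max: "\<And>\<tau>. \<tau> \<in> {0..b} \<Longrightarrow> exp (- (2 * c * \<tau>)) * v \<tau> \<le> exp (- (2 * c * s)) * v s"
    using continuous_attains_sup[OF compact_Icc, of 0 b] t by blast
  define m where "m = exp (- (2 * c * s)) * v s"
  have vm: "v \<tau> \<le> m * exp (2 * c * \<tau>)" if "\<tau> \<in> {0..b}" for \<tau>
    using max[OF that] by (simp add: m_def exp_minus field_simps)
  have "m \<le> 2 * a"
  proof (cases "m \<le> 0")
    case False
    have sb: "{0..s} \<subseteq> {0..b}" using s by auto
    have "integral {0..s} v \<le> integral {0..s} (\<lambda>\<tau>. m * exp (2 * c * \<tau>))"
      using sb vm
      by (intro integral_le integrable_continuous_interval continuous_on_subset[OF v sb] continuous_intros) auto
    also have "\<dots> = m * integral {0..s} (\<lambda>\<tau>. exp (2 * c * \<tau>))" by simp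
    also have "\<dots> \<le> m * (exp (2 * c * s) / (2 * c))"
      using False assms(3) s by (intro mult_left_mono integral_exp_le) auto
    finally have "c * integral {0..s} v \<le> c * (m * (exp (2 * c * s) / (2 * c)))"
      using \<open>0 < c\<close> by (intro mult_left_mono) auto
    also have "\<dots> = m * exp (2 * c * s) / 2" using \<open>0 < c\<close> by simp
    finally have "v s \<le> a + m * exp (2 * c * s) / 2" using le[OF s] by linarith
    moreover have "v s = m * exp (2 * c * s)" by (simp add: m_def exp_minus field_simps)
    ultimately have "m * exp (2 * c * s) \<le> 2 * a" by simp
    moreover have "m * 1 \<le> m * exp (2 * c * s)"
      using False s \<open>0 < c\<close> by (intro mult_left_mono) auto
    ultimately show ?thesis by simp
  qed (use \<open>0 \<le> a\<close> in simp)
  then have "m * exp (2 * c * t) \<le> 2 * a * exp (2 * c * t)" by (intro mult_right_mono) auto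
  with vm[OF t] show ?thesis by (rule order.trans)
qed

section \<open>Uniqueness and maximal solutions\<close>

lemma mild_equation_iff:
  assumes C0: "C0_semigroup S"
  shows "(I \<in> range (sun_embed S) \<and> y = z + inv (sun_embed S) I) \<longleftrightarrow> I = sun_embed S (y - z)"
  using sun_embed_inject[OF C0] by (auto simp: inv_f_f)

lemma solution_on_iff:
  assumes "C0_semigroup S"
  shows "solution_on S G \<phi> J u \<longleftrightarrow>
    is_interval J \<and> 0 \<in> J \<and> J \<subseteq> {0..} \<and> continuous_on J u \<and>
    (\<forall>t\<in>J. duhamel S (\<lambda>\<tau>. G (u \<tau>)) 0 t = sun_embed S (u t - S t \<phi>))"
  unfolding solution_on_def Let_def mild_equation_iff[OF assms] by simp

lemma continuous_map_compose_on:
  assumes G: "continuous_map euclidean (sun_star_topology S) G" and u: "continuous_on I u"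
  shows "continuous_map (top_of_set I) (sun_star_topology S) (\<lambda>\<tau>. G (u \<tau>))"
  using continuous_map_compose[of "top_of_set I" euclidean u, OF _ G] u
  by (simp add: o_def)

lemma continuous_map_euclidean_sun_star:
  "continuous_map euclidean (sun_star_topology S) G \<Longrightarrow> G x \<in> sun_star S"
  using continuous_map_image_subset_topspace[of euclidean "sun_star_topology S" G]
  by (auto simp: topspace_sun_star_topology)

text \<open>
  The vector \<open>w\<close> is typically a combination of solutions from which the initial data have cancelled. One
  factor \<open>M\<close> bounds the semigroup under the integral, the other is the loss in \<open>norm_le_sun_bound\<close>.
\<close>

lemma mild_difference_bound:
  assumes C0: "C0_semigroup S"
    and M: "1 \<le> M" "\<And>r. 0 \<le> r \<Longrightarrow> r \<le> max b 1 \<Longrightarrow> norm (S r) \<le> M"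
    and t: "t \<in> {0..b}"
    and f: "continuous_map (top_of_set {0..t}) (sun_star_topology S) f"
    and g: "continuous_on {0..t} g" "\<And>\<tau>. \<tau> \<in> {0..t} \<Longrightarrow> sun_star_norm S (f \<tau>) \<le> g \<tau>"
    and w: "\<And>x'. x' \<in> sun S \<Longrightarrow> blinfun_apply x' w = duhamel S f 0 t x'"
  shows "norm w \<le> M * M * integral {0..t} g"
proof -
  have in_star: "f \<tau> \<in> sun_star S" if "\<tau> \<in> {0..t}" for \<tau>
    using f that by (auto simp: continuous_map_sun_star_iff)
  have "0 \<le> integral {0..t} g"
    using g(2) sun_star_norm_nonneg[OF in_star] 
    by (intro integral_nonneg integrable_continuous_interval g(1)) (auto intro: order.trans)
  then have "norm w \<le> M * integral {0..t} g * M"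
    using M t unfolding atLeastAtMost_iff
    by (intro norm_le_sun_bound[OF C0]) (auto simp: w intro!: duhamel_bound[OF C0 _ f g])
  then show ?thesis by (simp add: algebra_simps)
qed

text \<open>
  At a time where the curves meet this is the local Lipschitz condition; at a time where they are apart,
  the left-hand side is bounded and the right-hand side is bounded away from \<open>0\<close>. A bisection argument
  turns the local constants into one for the whole interval.
\<close>

lemma locally_lipschitz_along_curves:
  fixes u v :: "real \<Rightarrow> 'a::banach"
  assumes lip: "locally_lipschitz_sun_star S G"
    and G: "continuous_map euclidean (sun_star_topology S) G"
    and u: "continuous_on {0..b} u" and v: "continuous_on {0..b} v" and b: "0 \<le> b"
  obtains l where "0 \<le> l"
    "\<And>\<tau>. \<tau> \<in> {0..b} \<Longrightarrow> sun_star_norm S (\<lambda>x'. G (u \<tau>) x' - G (v \<tau>) x') \<le> l * norm (u \<tau> - v \<tau>)"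
proof -
  define q where "q \<tau> = sun_star_norm S (\<lambda>x'. G (u \<tau>) x' - G (v \<tau>) x')" for \<tau>
  have qc: "continuous_on {0..b} q"
    unfolding q_def
    by (intro continuous_on_sun_star_norm sun_star_continuous_diff continuous_map_compose_on G u v)
  define P where "P x y \<longleftrightarrow> (\<exists>l\<ge>0. \<forall>\<tau>\<in>{x..y} \<inter> {0..b}. q \<tau> \<le> l * norm (u \<tau> - v \<tau>))" for x y
  have "P 0 b" using b
  proof (induction rule: Bolzano)
    case (trans x y z)
    then obtain l m where l: "0 \<le> l" "\<And>\<tau>. \<tau> \<in> {x..y} \<inter> {0..b} \<Longrightarrow> q \<tau> \<le> l * norm (u \<tau> - v \<tau>)"
      and m: "0 \<le> m" "\<And>\<tau>. \<tau> \<in> {y..z} \<inter> {0..b} \<Longrightarrow> q \<tau> \<le> m * norm (u \<tau> - v \<tau>)"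
      unfolding P_def by blast
    have "q \<tau> \<le> max l m * norm (u \<tau> - v \<tau>)" if \<tau>: "\<tau> \<in> {x..z} \<inter> {0..b}" for \<tau>
    proof (cases "\<tau> \<le> y")
      case True
      then have "q \<tau> \<le> l * norm (u \<tau> - v \<tau>)" using \<tau> by (intro l) auto
      also have "\<dots> \<le> max l m * norm (u \<tau> - v \<tau>)" by (intro mult_right_mono) auto
      finally show ?thesis .
    next
      case False
      then have "q \<tau> \<le> m * norm (u \<tau> - v \<tau>)" using \<tau> by (intro m) auto
      also have "\<dots> \<le> max l m * norm (u \<tau> - v \<tau>)" by (intro mult_right_mono) auto
      finally show ?thesis .
    qed
    then show ?case unfolding P_def using l(1) by (intro exI[of _ "max l m"]) auto
  next
    case (local x)
    then have x: "x \<in> {0..b}" by simp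
    have "\<exists>d>0. \<exists>l\<ge>0. \<forall>\<tau>\<in>{0..b}. dist \<tau> x < d \<longrightarrow> q \<tau> \<le> l * norm (u \<tau> - v \<tau>)"
    proof (cases "u x = v x")
      case True
      obtain r l where r: "0 < r" "0 \<le> l"
        and lr: "\<And>y z. y \<in> cball (u x) r \<Longrightarrow> z \<in> cball (u x) r \<Longrightarrow>
          sun_star_norm S (\<lambda>x'. G y x' - G z x') \<le> l * norm (y - z)"
        using lip unfolding locally_lipschitz_sun_star_def by metis
      obtain d1 where d1: "d1 > 0" "\<And>\<tau>. \<tau> \<in> {0..b} \<Longrightarrow> dist \<tau> x < d1 \<Longrightarrow> dist (u \<tau>) (u x) < r"
        using u x r(1) unfolding continuous_on_iff by blast
      obtain d2 where d2: "d2 > 0" "\<And>\<tau>. \<tau> \<in> {0..b} \<Longrightarrow> dist \<tau> x < d2 \<Longrightarrow> dist (v \<tau>) (v x) < r"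
        using v x r(1) unfolding continuous_on_iff by blast
      have "q \<tau> \<le> l * norm (u \<tau> - v \<tau>)" if "\<tau> \<in> {0..b}" "dist \<tau> x < min d1 d2" for \<tau>
        unfolding q_def using d1(2)[of \<tau>] d2(2)[of \<tau>] that True
        by (intro lr) (auto simp: dist_commute)
      then show ?thesis using d1(1) d2(1) r(2) by (intro exI[of _ "min d1 d2"]) auto
    next
      case False
      \<comment> \<open>Near \<open>x\<close> the distance of the curves stays above \<open>\<rho>\<close>, while \<open>q\<close> never exceeds its maximum \<open>q s\<close>.\<close>
      define \<rho> where "\<rho> = norm (u x - v x) / 2"
      have \<rho>: "\<rho> > 0" using False by (simp add: \<rho>_def)
      have "continuous_on {0..b} (\<lambda>\<tau>. norm (u \<tau> - v \<tau>))" using u v by (intro continuous_intros)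
      then obtain d where d: "d > 0" "\<And>\<tau>. \<tau> \<in> {0..b} \<Longrightarrow> dist \<tau> x < d \<Longrightarrow>
          dist (norm (u \<tau> - v \<tau>)) (norm (u x - v x)) < \<rho>"
        using x \<rho> unfolding continuous_on_iff by blast
      obtain s where s: "s \<in> {0..b}" "\<And>\<tau>. \<tau> \<in> {0..b} \<Longrightarrow> q \<tau> \<le> q s"
        using continuous_attains_sup[OF compact_Icc _ qc] x by blast
      have "q \<tau> \<le> \<bar>q s\<bar> / \<rho> * norm (u \<tau> - v \<tau>)" if \<tau>: "\<tau> \<in> {0..b}" "dist \<tau> x < d" for \<tau>
      proof -
        have "\<rho> \<le> norm (u \<tau> - v \<tau>)"
          using d(2)[OF \<tau>] unfolding \<rho>_def dist_real_def abs_less_iff by linarith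
        then have "\<bar>q s\<bar> / \<rho> * \<rho> \<le> \<bar>q s\<bar> / \<rho> * norm (u \<tau> - v \<tau>)"
          using \<rho> by (intro mult_left_mono) auto
        then show ?thesis using s(2)[OF \<tau>(1)] \<rho> by simp
      qed
      then show ?thesis using d(1) \<rho> by (intro exI[of _ d] conjI exI[of _ "\<bar>q s\<bar> / \<rho>"]) auto
    qed
    then obtain d l where d: "d > 0" "l \<ge> 0"
      "\<And>\<tau>. \<tau> \<in> {0..b} \<Longrightarrow> dist \<tau> x < d \<Longrightarrow> q \<tau> \<le> l * norm (u \<tau> - v \<tau>)" by blast
    have "P y z" if "y \<le> x" "x \<le> z" "z - y < d" for y z
      unfolding P_def using that d by (intro exI[of _ l]) (auto simp: dist_real_def)
    then show ?case using d(1) by blast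
  qed
  then show ?thesis using that unfolding P_def q_def by auto
qed

lemma initial_segment_subset:
  fixes t :: real
  assumes "is_interval J" "0 \<in> J" "t \<in> J"
  shows "{0..t} \<subseteq> J"
  using assms(1)[unfolded is_interval_1, rule_format, OF assms(2,3)] by auto

lemma solution_unique:
  assumes C0: "C0_semigroup S" and lip: "locally_lipschitz_sun_star S G"
    and G: "continuous_map euclidean (sun_star_topology S) G"
    and u: "solution_on S G \<phi> J u" "t \<in> J" and v: "solution_on S G \<phi> K v" "t \<in> K"
  shows "u t = v t"
proof -
  note u' = u(1)[unfolded solution_on_iff[OF C0]] and v' = v(1)[unfolded solution_on_iff[OF C0]]
  have t: "0 \<le> t" using u' u(2) by auto
  have sub: "{0..t} \<subseteq> J" "{0..t} \<subseteq> K"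
    using initial_segment_subset[of _ t] u' v' u(2) v(2) by auto
  have uc: "continuous_on {0..t} u" and vc: "continuous_on {0..t} v"
    using u' v' sub continuous_on_subset by blast+
  obtain l where l: "0 \<le> l" "\<And>\<tau>. \<tau> \<in> {0..t} \<Longrightarrow>
      sun_star_norm S (\<lambda>x'. G (u \<tau>) x' - G (v \<tau>) x') \<le> l * norm (u \<tau> - v \<tau>)"
    by (rule locally_lipschitz_along_curves[OF lip G uc vc t]) (rule that)
  obtain M where M: "1 \<le> M" "\<And>r. 0 \<le> r \<Longrightarrow> r \<le> max t 1 \<Longrightarrow> norm (S r) \<le> M"
    using C0_semigroup_bounded[OF C0] by metis
  define c where "c = M * M * l + 1"
  have c: "0 < c" using l(1) by (simp add: c_def add_nonneg_pos)
  have "norm (u t - v t) \<le> 2 * 0 * exp (2 * c * t)"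
  proof (rule gronwall[OF _ _ c])
    show "continuous_on {0..t} (\<lambda>\<tau>. norm (u \<tau> - v \<tau>))" using uc vc by (intro continuous_intros)
    fix s assume s: "s \<in> {0..t}"
    have cont: "continuous_on {0..s} u" "continuous_on {0..s} v"
      using uc vc s by (auto elim: continuous_on_subset)
    have "norm (u s - v s) \<le> M * M * integral {0..s} (\<lambda>\<tau>. l * norm (u \<tau> - v \<tau>))"
    proof (rule mild_difference_bound[OF C0 M s])
      show "continuous_map (top_of_set {0..s}) (sun_star_topology S) (\<lambda>\<tau> x'. G (u \<tau>) x' - G (v \<tau>) x')"
        by (intro sun_star_continuous_diff continuous_map_compose_on G cont)
      show "continuous_on {0..s} (\<lambda>\<tau>. l * norm (u \<tau> - v \<tau>))" using cont by (intro continuous_intros)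
      fix x' assume x': "x' \<in> sun S"
      have "s \<in> J" "s \<in> K" using sub s by auto
      then have eqs: "duhamel S (\<lambda>\<tau>. G (u \<tau>)) 0 s = sun_embed S (u s - S s \<phi>)"
        "duhamel S (\<lambda>\<tau>. G (v \<tau>)) 0 s = sun_embed S (v s - S s \<phi>)"
        using u' v' by blast+
      have "duhamel S (\<lambda>\<tau> x'. G (u \<tau>) x' - G (v \<tau>) x') 0 s x' =
          duhamel S (\<lambda>\<tau>. G (u \<tau>)) 0 s x' - duhamel S (\<lambda>\<tau>. G (v \<tau>)) 0 s x'"
        by (intro duhamel_diff C0 x' continuous_map_compose_on G cont)
      then show "x' (u s - v s) = duhamel S (\<lambda>\<tau> x'. G (u \<tau>) x' - G (v \<tau>) x') 0 s x'"
        unfolding eqs using x' by (simp add: sun_embed_def blinfun.diff_right)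
    qed (use l(2) s in auto)
    also have "\<dots> = M * M * l * integral {0..s} (\<lambda>\<tau>. norm (u \<tau> - v \<tau>))" by simp
    also have "\<dots> \<le> c * integral {0..s} (\<lambda>\<tau>. norm (u \<tau> - v \<tau>))"
      unfolding c_def using cont
      by (intro mult_right_mono integral_nonneg integrable_continuous_interval continuous_intros) auto
    finally show "norm (u s - v s) \<le> 0 + c * integral {0..s} (\<lambda>\<tau>. norm (u \<tau> - v \<tau>))" by simp
  qed (use t in auto)
  then show ?thesis by simp
qed

text \<open>
  The one-point interval counts as an interval of existence, so the family of all solutions with a given
  initial value is never empty.
\<close>

lemma trivial_solution:
  assumes C0: "C0_semigroup S"
  shows "solution_on S G \<phi> {0} (\<lambda>_. \<phi>)"
  unfolding solution_on_iff[OF C0]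
  using duhamel_refl[where S = S and f = "\<lambda>_. G \<phi>" and t = 0] by (simp add: is_interval_1 C0_semigroup_0[OF C0])

text \<open>
  By uniqueness all solutions can be glued. Continuity at \<open>t\<close> is inherited from one solution that is
  defined beyond \<open>t\<close>, or, when \<open>t\<close> is the last point of the union, from one that is defined up to \<open>t\<close>.
\<close>

lemma greatest_solution:
  assumes C0: "C0_semigroup S" and lip: "locally_lipschitz_sun_star S G"
    and G: "continuous_map euclidean (sun_star_topology S) G"
  obtains J u where "solution_on S G \<phi> J u"
    "\<And>K v. solution_on S G \<phi> K v \<Longrightarrow> K \<subseteq> J \<and> (\<forall>t\<in>K. v t = u t)"
proof -
  define J where "J = \<Union>{K. \<exists>v. solution_on S G \<phi> K v}"
  define u where "u t = (SOME y. \<exists>K v. solution_on S G \<phi> K v \<and> t \<in> K \<and> y = v t)" for t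
  have uv: "v t = u t" if v: "solution_on S G \<phi> K v" "t \<in> K" for K v t
  proof -
    have "\<exists>K v. solution_on S G \<phi> K v \<and> t \<in> K \<and> u t = v t"
      unfolding u_def by (rule someI_ex) (use v in blast)
    then show ?thesis using solution_unique[OF C0 lip G v] by metis
  qed
  have sub: "K \<subseteq> J" if "solution_on S G \<phi> K v" for K v using that by (auto simp: J_def)
  have ex: "\<exists>K v. solution_on S G \<phi> K v \<and> t \<in> K" if "t \<in> J" for t using that by (auto simp: J_def)
  have initial: "{0..t} \<subseteq> K" if "solution_on S G \<phi> K v" "t \<in> K" for K v t
    using that initial_segment_subset[of K t] by (simp add: solution_on_iff[OF C0])
  have nonneg: "J \<subseteq> {0..}" using ex by (auto simp: solution_on_iff[OF C0])
  have int: "is_interval J"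
    unfolding is_interval_1
  proof (intro ballI allI impI)
    fix r s t assume rs: "r \<in> J" "s \<in> J" "r \<le> t \<and> t \<le> s"
    obtain K v where "solution_on S G \<phi> K v" "s \<in> K" using ex[OF rs(2)] by blast
    moreover have "t \<in> {0..s}" using rs nonneg by auto
    ultimately show "t \<in> J" using initial sub by blast
  qed
  have eq: "duhamel S (\<lambda>\<tau>. G (u \<tau>)) 0 t = sun_embed S (u t - S t \<phi>)" if "t \<in> J" for t
  proof -
    obtain K v where v: "solution_on S G \<phi> K v" "t \<in> K" using ex[OF \<open>t \<in> J\<close>] by blast
    have "duhamel S (\<lambda>\<tau>. G (u \<tau>)) 0 t = duhamel S (\<lambda>\<tau>. G (v \<tau>)) 0 t"
      using uv[OF v(1)] initial[OF v] by (intro duhamel_cong) (auto simp: subset_iff)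
    also have "\<dots> = sun_embed S (v t - S t \<phi>)" using v by (auto simp: solution_on_iff[OF C0])
    finally show ?thesis using uv[OF v] by simp
  qed
  have cont: "continuous_on J u"
  proof -
    have "continuous (at t within J) u" if t: "t \<in> J" for t
    proof (cases "\<exists>s\<in>J. t < s")
      case True
      then obtain s where s: "s \<in> J" "t < s" by blast
      obtain K v where v: "solution_on S G \<phi> K v" "s \<in> K" using ex[OF s(1)] by blast
      have sK: "{0..s} \<subseteq> K" by (rule initial[OF v])
      have "continuous_on {0..s} v" using v sK by (auto simp: solution_on_iff[OF C0] elim: continuous_on_subset)
      then have "continuous_on {0..s} u" using uv[OF v(1)] sK by (subst continuous_on_cong[OF refl]) auto
      then have "continuous (at t within {0..s}) u"
        using t s nonneg by (auto simp: continuous_on_eq_continuous_within)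
      moreover have "at t within J = at t within {0..s}"
        using nonneg s sK sub[OF v(1)] by (intro at_within_nhd[of t "{..<s}"]) auto
      ultimately show ?thesis by simp
    next
      case False
      obtain K v where v: "solution_on S G \<phi> K v" "t \<in> K" using ex[OF t] by blast
      have "J = {0..t}" using False nonneg initial[OF v] sub[OF v(1)] by force
      moreover have "continuous_on {0..t} v"
        using v initial[OF v] by (auto simp: solution_on_iff[OF C0] elim: continuous_on_subset)
      then have "continuous_on {0..t} u"
        using uv[OF v(1)] initial[OF v] by (subst continuous_on_cong[OF refl]) auto
      ultimately show ?thesis using t by (simp add: continuous_on_eq_continuous_within)
    qed
    then show ?thesis by (simp add: continuous_on_eq_continuous_within)
  qed
  have "0 \<in> J" using sub[OF trivial_solution[OF C0]] by blast
  then have "solution_on S G \<phi> J u"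
    using int nonneg cont eq by (auto simp: solution_on_iff[OF C0])
  then show ?thesis using that sub uv by blast
qed

text \<open>
  The greatest solution is the only maximal one, so the two definite descriptions in the definition of
  the semiflow denote its interval and its values.
\<close>

theorem semiflow_eq_greatest_solution:
  assumes C0: "C0_semigroup S" and lip: "locally_lipschitz_sun_star S G"
    and G: "continuous_map euclidean (sun_star_topology S) G"
  shows "solution_on S G \<phi> (existence_interval S G \<phi>) (\<lambda>t. semiflow S G t \<phi>)"
    and "solution_on S G \<phi> K v \<Longrightarrow> t \<in> K \<Longrightarrow> t \<in> existence_interval S G \<phi> \<and> semiflow S G t \<phi> = v t"
proof -
  obtain J u where u: "solution_on S G \<phi> J u"
    and greatest: "\<And>K v. solution_on S G \<phi> K v \<Longrightarrow> K \<subseteq> J \<and> (\<forall>t\<in>K. v t = u t)"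
    using greatest_solution[OF C0 lip G] by metis
  have max: "maximal_solution S G \<phi> J u"
    unfolding maximal_solution_def using u greatest by blast
  have unique: "K = J" if "maximal_solution S G \<phi> K v" for K v
  proof -
    have v: "solution_on S G \<phi> K v" using that by (simp add: maximal_solution_def)
    have "K \<subseteq> J" "\<forall>t\<in>K. u t = v t" using greatest[OF v] by auto
    then have "J = K" using that u unfolding maximal_solution_def by blast
    then show ?thesis by simp
  qed
  have J: "existence_interval S G \<phi> = J"
    unfolding existence_interval_def using max unique by (intro the_equality) blast+
  have sf: "semiflow S G t \<phi> = u t" if "t \<in> J" for t
    unfolding semiflow_def J
  proof (rule the_equality)
    show "\<exists>v. maximal_solution S G \<phi> J v \<and> u t = v t" using max by blast
    fix y assume "\<exists>v. maximal_solution S G \<phi> J v \<and> y = v t"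
    then obtain v where "maximal_solution S G \<phi> J v" "y = v t" by blast
    then show "y = u t" using greatest[of J v] that by (simp add: maximal_solution_def)
  qed
  have "continuous_on J (\<lambda>t. semiflow S G t \<phi>)"
    using u sf by (subst continuous_on_cong[OF refl]) (auto simp: solution_on_iff[OF C0])
  moreover have "duhamel S (\<lambda>\<tau>. G (semiflow S G \<tau> \<phi>)) 0 t = sun_embed S (semiflow S G t \<phi> - S t \<phi>)"
    if t: "t \<in> J" for t
  proof -
    have "{0..t} \<subseteq> J" using u t initial_segment_subset[of J t] by (simp add: solution_on_iff[OF C0])
    then have "duhamel S (\<lambda>\<tau>. G (semiflow S G \<tau> \<phi>)) 0 t = duhamel S (\<lambda>\<tau>. G (u \<tau>)) 0 t"
      using sf by (intro duhamel_cong) auto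
    then show ?thesis using u t sf by (simp add: solution_on_iff[OF C0])
  qed
  ultimately show "solution_on S G \<phi> (existence_interval S G \<phi>) (\<lambda>t. semiflow S G t \<phi>)"
    using u by (simp add: J solution_on_iff[OF C0])
  show "t \<in> existence_interval S G \<phi> \<and> semiflow S G t \<phi> = v t"
    if "solution_on S G \<phi> K v" "t \<in> K"
    using greatest[OF that(1)] that(2) sf by (auto simp: J)
qed

section \<open>Existence for globally Lipschitz perturbations\<close>

lemma duhamel_curve:
  assumes C0: "C0_semigroup S" and Y: "admissible_range S Y"
    and G: "continuous_map euclidean (sun_star_topology S) G" "range G \<subseteq> Y"
    and u: "continuous_on {0..b} u"
  obtains w where "continuous_on {0..b} w"
    "\<And>t. t \<in> {0..b} \<Longrightarrow> duhamel S (\<lambda>\<tau>. G (u \<tau>)) 0 t = sun_embed S (w t)"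
proof -
  have f: "continuous_map (top_of_set {0..b}) (sun_star_topology S) (\<lambda>\<tau>. G (u \<tau>))"
    by (rule continuous_map_compose_on[OF G(1) u])
  have "duhamel S (\<lambda>\<tau>. G (u \<tau>)) 0 t \<in> range (sun_embed S)" if "t \<in> {0..b}" for t
    using that G(2) by (intro duhamel_in_range[OF C0 Y f]) auto
  then have "\<forall>t\<in>{0..b}. \<exists>y. duhamel S (\<lambda>\<tau>. G (u \<tau>)) 0 t = sun_embed S y" by blast
  then obtain w where w: "\<And>t. t \<in> {0..b} \<Longrightarrow> duhamel S (\<lambda>\<tau>. G (u \<tau>)) 0 t = sun_embed S (w t)"
    by (elim bchoice[THEN exE]) blast
  from that[OF continuous_on_duhamel[OF C0 f w] w] show ?thesis by blast
qed

text \<open>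
  The unknown is \<open>v t = exp (- c t) * u t\<close>. In this variable the Volterra operator has Lipschitz constant at
  most \<open>M * M * l / c\<close>, because \<open>\<integral> exp (c \<tau>) d\<tau> \<le> exp (c t) / c\<close>; the choice of \<open>c\<close> makes it less than \<open>1 / 2\<close>
  however long the interval is. To have a complete space at hand, functions on \<open>[0, b]\<close> are regarded as
  bounded continuous functions on the line that are constant outside the interval.
\<close>

theorem lipschitz_solution_exists:
  fixes S :: "real \<Rightarrow> 'a::banach \<Rightarrow>\<^sub>L 'a"
  assumes C0: "C0_semigroup S" and Y: "admissible_range S Y"
    and G: "continuous_map euclidean (sun_star_topology S) G" "range G \<subseteq> Y"
    and lip: "\<And>y z. sun_star_norm S (\<lambda>x'. G y x' - G z x') \<le> l * norm (y - z)" "0 \<le> l"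
    and b: "0 \<le> b"
  obtains u where "solution_on S G \<phi> {0..b} u"
proof -
  obtain M where M: "1 \<le> M" "\<And>r. 0 \<le> r \<Longrightarrow> r \<le> max b 1 \<Longrightarrow> norm (S r) \<le> M"
    using C0_semigroup_bounded[OF C0] by metis
  define c where "c = 2 * (M * M * l) + 1"
  have c: "0 < c" using lip(2) by (simp add: c_def add_nonneg_pos)
  define P where "P v g \<longleftrightarrow> (\<forall>t. g t = g (clamp 0 b t)) \<and> (\<forall>t\<in>{0..b}.
      duhamel S (\<lambda>\<tau>. G (exp (c * \<tau>) *\<^sub>R v \<tau>)) 0 t = sun_embed S (exp (c * t) *\<^sub>R g t - S t \<phi>))"
    for v g :: "real \<Rightarrow>\<^sub>C 'a"
  have "\<exists>g. P v g" for v
  proof -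
    have "continuous_on {0..b} (\<lambda>\<tau>. exp (c * \<tau>) *\<^sub>R v \<tau>)" by (intro continuous_intros) auto
    from duhamel_curve[OF C0 Y G this]
    obtain w where w: "continuous_on {0..b} w" "\<And>t. t \<in> {0..b} \<Longrightarrow>
        duhamel S (\<lambda>\<tau>. G (exp (c * \<tau>) *\<^sub>R v \<tau>)) 0 t = sun_embed S (w t)" by blast
    have "continuous_on (cbox 0 b) (\<lambda>t. exp (- (c * t)) *\<^sub>R (S t \<phi> + w t))"
      using w(1) continuous_on_subset[OF C0_semigroup_continuous_on[OF C0], of "{0..b}" \<phi>]
      by (auto intro!: continuous_intros)
    from continuous_on_cbox_bcontfunE[OF this]
    obtain g :: "real \<Rightarrow>\<^sub>C 'a"
      where g: "\<And>t. t \<in> cbox 0 b \<Longrightarrow> g t = exp (- (c * t)) *\<^sub>R (S t \<phi> + w t)"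
        "\<And>t. g t = exp (- (c * clamp 0 b t)) *\<^sub>R (S (clamp 0 b t) \<phi> + w (clamp 0 b t))" by metis
    have "clamp 0 b t \<in> cbox 0 b" for t using b by (intro clamp_in_interval) simp
    then have "g t = g (clamp 0 b t)" for t using g by metis
    moreover have "exp (c * t) *\<^sub>R g t - S t \<phi> = w t" if "t \<in> {0..b}" for t
      using g(1)[of t] that by (simp add: exp_minus)
    ultimately have "P v g" unfolding P_def using w(2) by auto
    then show ?thesis by blast
  qed
  then obtain F where PF: "\<And>v. P v (F v)" by metis
  have F_clamp: "F v t = F v (clamp 0 b t)" for v t
    using PF[of v] unfolding P_def by blast
  have F: "duhamel S (\<lambda>\<tau>. G (exp (c * \<tau>) *\<^sub>R v \<tau>)) 0 t = sun_embed S (exp (c * t) *\<^sub>R F v t - S t \<phi>)"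
    if "t \<in> {0..b}" for v :: "real \<Rightarrow>\<^sub>C 'a" and t
    using PF[of v] that unfolding P_def by blast
  have contract: "dist (F v) (F w) \<le> 1 / 2 * dist v w" for v w
  proof (rule dist_bound)
    fix r
    define t where "t = clamp 0 b r"
    have t: "t \<in> {0..b}" unfolding t_def using clamp_in_interval[of 0 b r] b by simp
    have cont: "continuous_on {0..t} (\<lambda>\<tau>. exp (c * \<tau>) *\<^sub>R y \<tau>)" for y :: "real \<Rightarrow>\<^sub>C 'a"
      by (intro continuous_intros) auto
    have "norm (exp (c * t) *\<^sub>R (F v t - F w t)) \<le> M * M * integral {0..t} (\<lambda>\<tau>. l * dist v w * exp (c * \<tau>))"
    proof (rule mild_difference_bound[OF C0 M t])
      show "continuous_map (top_of_set {0..t}) (sun_star_topology S)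
          (\<lambda>\<tau> x'. G (exp (c * \<tau>) *\<^sub>R v \<tau>) x' - G (exp (c * \<tau>) *\<^sub>R w \<tau>) x')"
        by (intro sun_star_continuous_diff continuous_map_compose_on G cont)
      show "continuous_on {0..t} (\<lambda>\<tau>. l * dist v w * exp (c * \<tau>))" by (intro continuous_intros)
      show "sun_star_norm S (\<lambda>x'. G (exp (c * \<tau>) *\<^sub>R v \<tau>) x' - G (exp (c * \<tau>) *\<^sub>R w \<tau>) x')
          \<le> l * dist v w * exp (c * \<tau>)" for \<tau>
      proof -
        have "norm (exp (c * \<tau>) *\<^sub>R v \<tau> - exp (c * \<tau>) *\<^sub>R w \<tau>) = exp (c * \<tau>) * dist (v \<tau>) (w \<tau>)"
          by (simp add: dist_norm scaleR_diff_right[symmetric])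
        also have "\<dots> \<le> exp (c * \<tau>) * dist v w" by (intro mult_left_mono dist_bounded) simp
        finally have "l * norm (exp (c * \<tau>) *\<^sub>R v \<tau> - exp (c * \<tau>) *\<^sub>R w \<tau>) \<le> l * (exp (c * \<tau>) * dist v w)"
          using lip(2) by (rule mult_left_mono)
        with lip(1)[of "exp (c * \<tau>) *\<^sub>R v \<tau>" "exp (c * \<tau>) *\<^sub>R w \<tau>"] show ?thesis
          by (simp add: algebra_simps)
      qed
      fix x' assume x': "x' \<in> sun S"
      have "duhamel S (\<lambda>\<tau> x'. G (exp (c * \<tau>) *\<^sub>R v \<tau>) x' - G (exp (c * \<tau>) *\<^sub>R w \<tau>) x') 0 t x' =
          duhamel S (\<lambda>\<tau>. G (exp (c * \<tau>) *\<^sub>R v \<tau>)) 0 t x' - duhamel S (\<lambda>\<tau>. G (exp (c * \<tau>) *\<^sub>R w \<tau>)) 0 t x'"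
        by (intro duhamel_diff C0 x' continuous_map_compose_on G cont)
      then show "x' (exp (c * t) *\<^sub>R (F v t - F w t)) =
          duhamel S (\<lambda>\<tau> x'. G (exp (c * \<tau>) *\<^sub>R v \<tau>) x' - G (exp (c * \<tau>) *\<^sub>R w \<tau>) x') 0 t x'"
        unfolding F[OF t] using x' by (simp add: sun_embed_def blinfun.bilinear_simps algebra_simps)
    qed
    also have "\<dots> = M * M * (l * dist v w) * integral {0..t} (\<lambda>\<tau>. exp (c * \<tau>))" by simp
    also have "\<dots> \<le> M * M * (l * dist v w) * (exp (c * t) / c)"
      using M(1) lip(2) c t by (intro mult_left_mono integral_exp_le) auto
    also have "\<dots> = exp (c * t) * ((M * M * l) / c * dist v w)" by simp
    also have "\<dots> \<le> exp (c * t) * (1 / 2 * dist v w)"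
      using c by (intro mult_left_mono mult_right_mono) (auto simp: c_def field_simps)
    finally have "dist (F v t) (F w t) \<le> 1 / 2 * dist v w" by (simp add: dist_norm)
    then show "dist (F v r) (F w r) \<le> 1 / 2 * dist v w"
      unfolding t_def F_clamp[of v r, symmetric] F_clamp[of w r, symmetric] .
  qed
  then have "\<exists>!v. F v = v" by (intro banach_fix_type[of "1 / 2"]) auto
  then obtain v where v: "F v = v" by blast
  have "solution_on S G \<phi> {0..b} (\<lambda>t. exp (c * t) *\<^sub>R v t)"
    unfolding solution_on_iff[OF C0] using b F[of _ v, unfolded v]
    by (auto simp: is_interval_cc intro!: continuous_intros)
  then show ?thesis by (rule that)
qed

section \<open>Truncation\<close>

definition radial_retraction :: "real \<Rightarrow> 'a::real_normed_vector \<Rightarrow> 'a" where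
  "radial_retraction r y = (r / max r (norm y)) *\<^sub>R y"

lemma radial_retraction_id: "0 < r \<Longrightarrow> norm y \<le> r \<Longrightarrow> radial_retraction r y = y"
  by (simp add: radial_retraction_def max_absorb1)

lemma norm_radial_retraction: "0 < r \<Longrightarrow> norm (radial_retraction r y) \<le> r"
  by (auto simp: radial_retraction_def max_def field_simps)

text \<open>
  Splitting the difference into a change of direction and a change of radius, each of which is bounded by
  \<open>norm (y - z)\<close>, gives the constant \<open>2\<close>, which is valid in every normed space.
\<close>

lemma radial_retraction_lipschitz:
  assumes r: "0 < r"
  shows "norm (radial_retraction r y - radial_retraction r z) \<le> 2 * norm (y - z)"
proof -
  define a where "a = max r (norm y)"
  define b where "b = max r (norm z)"
  have a: "r \<le> a" "0 < a" and b: "norm z \<le> b" "0 < b" using r by (auto simp: a_def b_def)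
  have ab: "\<bar>b - a\<bar> \<le> norm (y - z)"
    using norm_triangle_ineq3[of y z] by (auto simp: a_def b_def)
  have "radial_retraction r y - radial_retraction r z = (r / a) *\<^sub>R (y - z) + (r * (b - a) / (a * b)) *\<^sub>R z"
    using a(2) b(2) by (simp add: radial_retraction_def a_def[symmetric] b_def[symmetric]
        scaleR_diff_right diff_divide_distrib right_diff_distrib scaleR_diff_left)
  also have "norm \<dots> \<le> r / a * norm (y - z) + r / a * \<bar>b - a\<bar> * (norm z / b)"
    using norm_triangle_ineq[of "(r / a) *\<^sub>R (y - z)" "(r * (b - a) / (a * b)) *\<^sub>R z"] r a b
    by (simp add: abs_mult)
  also have "\<dots> \<le> 1 * norm (y - z) + 1 * norm (y - z) * 1"
    using r a b ab by (intro add_mono mult_mono) auto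
  finally show ?thesis by simp
qed

section \<open>Differentiability of the semiflow at an equilibrium\<close>

lemma has_sun_star_derivative_bounded:
  assumes "has_sun_star_derivative S G L x"
  obtains C where "0 \<le> C" "\<And>h. L h \<in> sun_star S" "\<And>x'. linear (\<lambda>h. L h x')"
    "\<And>h. sun_star_norm S (L h) \<le> C * norm h"
proof -
  obtain C where C: "\<And>h. sun_star_norm S (L h) \<le> C * norm h"
    using assms unfolding has_sun_star_derivative_def by blast
  have "sun_star_norm S (L h) \<le> \<bar>C\<bar> * norm h" for h
    using C[of h] mult_right_mono[OF abs_ge_self, of "norm h" C] by simp
  then show ?thesis using that[of "\<bar>C\<bar>"] assms unfolding has_sun_star_derivative_def by simp
qed

lemma has_sun_star_derivative_remainder:
  assumes der: "has_sun_star_derivative S G L x" and \<eta>: "0 < \<eta>"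
  obtains r where "0 < r" "\<And>y. norm (y - x) \<le> r \<Longrightarrow>
    sun_star_norm S (\<lambda>x'. G y x' - G x x' - L (y - x) x') \<le> \<eta> * norm (y - x)"
proof -
  have "\<forall>\<^sub>F h in at 0. sun_star_norm S (\<lambda>x'. G (x + h) x' - G x x' - L h x') / norm h < \<eta>"
    using der \<eta> unfolding has_sun_star_derivative_def by (auto intro: order_tendstoD(2))
  then obtain d where d: "0 < d" "\<And>h. h \<noteq> 0 \<Longrightarrow> norm h < d \<Longrightarrow>
      sun_star_norm S (\<lambda>x'. G (x + h) x' - G x x' - L h x') / norm h < \<eta>"
    by (auto simp: eventually_at)
  have "sun_star_norm S (\<lambda>x'. G y x' - G x x' - L (y - x) x') \<le> \<eta> * norm (y - x)"
    if y: "norm (y - x) \<le> d / 2" for y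
  proof (cases "y = x")
    case True
    have "L 0 x' = 0" for x'
      using der unfolding has_sun_star_derivative_def by (metis linear_0)
    then show ?thesis using True by (intro sun_star_norm_leI) simp
  next
    case False
    then show ?thesis using d(2)[of "y - x"] y d(1) by (simp add: divide_less_eq)
  qed
  then show ?thesis using that[of "d / 2"] d(1) by simp
qed

lemma sun_star_linear_continuous:
  fixes u :: "real \<Rightarrow> 'a::banach"
  assumes L: "\<And>h. L h \<in> sun_star S" "\<And>x'. linear (\<lambda>h. L h x')"
    "\<And>h. sun_star_norm S (L h) \<le> C * norm h"
    and u: "continuous_on I u"
  shows "continuous_map (top_of_set I) (sun_star_topology S) (\<lambda>t. L (u t))"
proof (rule sun_star_continuousI)
  show "sun_star_norm S (\<lambda>x'. L (u s) x' - L (u t) x') \<le> C * norm (u s - u t)" for s t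
  proof -
    have "(\<lambda>x'. L (u s) x' - L (u t) x') = L (u s - u t)"
      using linear_diff[OF L(2)] by (intro ext) simp
    then show ?thesis using L(3) by simp
  qed
  show "((\<lambda>s. C * norm (u s - u t)) \<longlongrightarrow> 0) (at t within I)" if "t \<in> I" for t
    using u that
    by (intro tendsto_mult_right_zero) (auto simp: continuous_on_def tendsto_norm_zero_iff Lim_null[of u])
qed (rule L(1))

lemma perturbed_semigroup_iff:
  assumes "C0_semigroup S"
  shows "perturbed_semigroup S L T \<longleftrightarrow> C0_semigroup T \<and>
    (\<forall>x. \<forall>t\<ge>0. duhamel S (\<lambda>\<tau>. L (T \<tau> x)) 0 t = sun_embed S (T t x - S t x))"
  unfolding perturbed_semigroup_def Let_def mild_equation_iff[OF assms] by simp

text \<open>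
  \<open>H\<close> is the truncated map. The bound \<open>r / C\<close> on the initial deviation is chosen such that the Gronwall
  estimate keeps the truncated orbit in the ball where \<open>H\<close> and \<open>G\<close> coincide.
\<close>

lemma solution_near_equilibrium:
  fixes S :: "real \<Rightarrow> 'a::banach \<Rightarrow>\<^sub>L 'a"
  assumes C0: "C0_semigroup S" and lip: "locally_lipschitz_sun_star S G"
    and adm: "admissible_perturbation S G"
    and eq: "\<And>t. 0 \<le> t \<Longrightarrow> duhamel S (\<lambda>\<tau>. G \<psi>) 0 t = sun_embed S (\<psi> - S t \<psi>)"
    and b: "0 \<le> b"
  obtains \<delta> C where "0 < \<delta>" "1 \<le> C" "\<And>\<phi>. norm (\<phi> - \<psi>) \<le> \<delta> \<Longrightarrow>
    \<exists>u. solution_on S G \<phi> {0..b} u \<and> (\<forall>t\<in>{0..b}. norm (u t - \<psi>) \<le> C * norm (\<phi> - \<psi>))"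
proof -
  obtain Y where G: "continuous_map euclidean (sun_star_topology S) G"
    and Y: "admissible_range S Y" "range G \<subseteq> Y"
    using adm unfolding admissible_perturbation_def by blast
  obtain r l where r: "0 < r" "0 \<le> l" and lr: "\<And>y z. y \<in> cball \<psi> r \<Longrightarrow> z \<in> cball \<psi> r \<Longrightarrow>
      sun_star_norm S (\<lambda>x'. G y x' - G z x') \<le> l * norm (y - z)"
    using lip unfolding locally_lipschitz_sun_star_def by metis
  obtain M where M: "1 \<le> M" "\<And>r. 0 \<le> r \<Longrightarrow> r \<le> max b 1 \<Longrightarrow> norm (S r) \<le> M"
    using C0_semigroup_bounded[OF C0] by metis
  define \<rho> where "\<rho> y = \<psi> + radial_retraction r (y - \<psi>)" for y
  define H where "H y = G (\<rho> y)" for y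
  have \<rho>_lip: "norm (\<rho> y - \<rho> z) \<le> 2 * norm (y - z)" for y z
    using radial_retraction_lipschitz[OF r(1), of "y - \<psi>" "z - \<psi>"] by (simp add: \<rho>_def)
  have \<rho>_ball: "\<rho> y \<in> cball \<psi> r" for y
    using norm_radial_retraction[OF r(1), of "y - \<psi>"] by (simp add: \<rho>_def dist_norm)
  have \<rho>_id: "\<rho> y = y" if "norm (y - \<psi>) \<le> r" for y
    using radial_retraction_id[OF r(1) that] by (simp add: \<rho>_def)
  have H_lip: "sun_star_norm S (\<lambda>x'. H y x' - H z x') \<le> (2 * l) * norm (y - z)" for y z
    using lr[OF \<rho>_ball \<rho>_ball, of y z] mult_left_mono[OF \<rho>_lip r(2), of y z]
    by (simp add: H_def)
  have "continuous_on UNIV \<rho>"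
    unfolding continuous_on_iff
  proof (intro ballI allI impI)
    fix x :: 'a and e :: real assume "0 < e"
    then show "\<exists>d>0. \<forall>x'\<in>UNIV. dist x' x < d \<longrightarrow> dist (\<rho> x') (\<rho> x) < e"
      by (intro exI[of _ "e / 2"]) (auto simp: dist_norm intro!: le_less_trans[OF \<rho>_lip])
  qed
  then have H: "continuous_map euclidean (sun_star_topology S) H"
    using continuous_map_compose_on[OF G, of UNIV \<rho>] by (simp add: H_def[abs_def])
  have HY: "range H \<subseteq> Y" using Y(2) by (auto simp: H_def)
  define c where "c = M * M * (2 * l) + 1"
  have c: "0 < c" using r(2) by (simp add: c_def add_nonneg_pos)
  define C where "C = 2 * M * exp (2 * c * b)"
  have C: "1 \<le> C"
  proof -
    have "1 * 1 \<le> (2 * M) * exp (2 * c * b)" using M(1) c b by (intro mult_mono) auto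
    then show ?thesis by (simp add: C_def)
  qed
  have "\<exists>u. solution_on S G \<phi> {0..b} u \<and> (\<forall>t\<in>{0..b}. norm (u t - \<psi>) \<le> C * norm (\<phi> - \<psi>))"
    if \<phi>: "norm (\<phi> - \<psi>) \<le> r / C" for \<phi>
  proof -
    obtain u where u: "solution_on S H \<phi> {0..b} u"
      using lipschitz_solution_exists[OF C0 Y(1) H HY H_lip _ b] r(2) by (metis mult_nonneg_nonneg zero_le_numeral)
    note u' = u[unfolded solution_on_iff[OF C0]]
    have uc: "continuous_on {0..b} u" using u' by blast
    have close: "norm (u t - \<psi>) \<le> C * norm (\<phi> - \<psi>)" if t: "t \<in> {0..b}" for t
    proof -
      have "norm (u t - \<psi>) \<le> 2 * (M * norm (\<phi> - \<psi>)) * exp (2 * c * t)"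
      proof (rule gronwall[OF _ _ c _ t])
        show "continuous_on {0..b} (\<lambda>\<tau>. norm (u \<tau> - \<psi>))" using uc by (intro continuous_intros)
        show "0 \<le> M * norm (\<phi> - \<psi>)" using M(1) by simp
        fix s assume s: "s \<in> {0..b}"
        have cont: "continuous_on {0..s} u" using uc s by (auto elim: continuous_on_subset)
        have "norm ((u s - \<psi>) - S s (\<phi> - \<psi>)) \<le> M * M * integral {0..s} (\<lambda>\<tau>. (2 * l) * norm (u \<tau> - \<psi>))"
        proof (rule mild_difference_bound[OF C0 M s])
          show "continuous_map (top_of_set {0..s}) (sun_star_topology S) (\<lambda>\<tau> x'. H (u \<tau>) x' - H \<psi> x')"
            by (intro sun_star_continuous_diff continuous_map_compose_on H cont continuous_on_const)
          show "continuous_on {0..s} (\<lambda>\<tau>. (2 * l) * norm (u \<tau> - \<psi>))" using cont by (intro continuous_intros)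
          fix x' assume x': "x' \<in> sun S"
          have 1: "duhamel S (\<lambda>\<tau>. H (u \<tau>)) 0 s = sun_embed S (u s - S s \<phi>)" using u' s by blast
          have 2: "duhamel S (\<lambda>\<tau>. H \<psi>) 0 s = sun_embed S (\<psi> - S s \<psi>)"
            using eq[of s] s \<rho>_id[of \<psi>] r(1) by (simp add: H_def)
          have "duhamel S (\<lambda>\<tau> x'. H (u \<tau>) x' - H \<psi> x') 0 s x' =
              duhamel S (\<lambda>\<tau>. H (u \<tau>)) 0 s x' - duhamel S (\<lambda>\<tau>. H \<psi>) 0 s x'"
            by (intro duhamel_diff C0 x' continuous_map_compose_on H cont continuous_on_const)
          then show "x' ((u s - \<psi>) - S s (\<phi> - \<psi>)) = duhamel S (\<lambda>\<tau> x'. H (u \<tau>) x' - H \<psi> x') 0 s x'"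
            unfolding 1 2 using x' by (simp add: sun_embed_def blinfun.bilinear_simps)
        qed (use H_lip in auto)
        also have "\<dots> = M * M * (2 * l) * integral {0..s} (\<lambda>\<tau>. norm (u \<tau> - \<psi>))" by simp
        also have "\<dots> \<le> c * integral {0..s} (\<lambda>\<tau>. norm (u \<tau> - \<psi>))"
          unfolding c_def using cont
          by (intro mult_right_mono integral_nonneg integrable_continuous_interval continuous_intros) auto
        finally have "norm ((u s - \<psi>) - S s (\<phi> - \<psi>)) \<le> c * integral {0..s} (\<lambda>\<tau>. norm (u \<tau> - \<psi>))" .
        moreover have "norm (S s (\<phi> - \<psi>)) \<le> M * norm (\<phi> - \<psi>)"
          using norm_blinfun[of "S s" "\<phi> - \<psi>"] mult_right_mono[OF M(2), of s "norm (\<phi> - \<psi>)"] s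
          by (simp add: le_max_iff_disj)
        ultimately show "norm (u s - \<psi>) \<le> M * norm (\<phi> - \<psi>) + c * integral {0..s} (\<lambda>\<tau>. norm (u \<tau> - \<psi>))"
          using norm_triangle_sub[of "u s - \<psi>" "S s (\<phi> - \<psi>)"] by linarith
      qed
      also have "\<dots> \<le> 2 * (M * norm (\<phi> - \<psi>)) * exp (2 * c * b)"
        using t c M(1) by (intro mult_left_mono) auto
      finally show ?thesis by (simp add: C_def algebra_simps)
    qed
    have "norm (u t - \<psi>) \<le> r" if "t \<in> {0..b}" for t
      using close[OF that] \<phi> C by (simp add: field_simps)
    then have HG: "H (u t) = G (u t)" if "t \<in> {0..b}" for t using \<rho>_id that by (simp add: H_def)
    have "duhamel S (\<lambda>\<tau>. G (u \<tau>)) 0 t = duhamel S (\<lambda>\<tau>. H (u \<tau>)) 0 t" if "t \<in> {0..b}" for t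
      using HG that by (intro duhamel_cong) auto
    then have "solution_on S G \<phi> {0..b} u" using u' unfolding solution_on_iff[OF C0] by auto
    then show ?thesis using close by blast
  qed
  then show ?thesis using that[of "r / C" C] r(1) C by simp
qed

theorem proposition25:
  fixes T0 T :: "real \<Rightarrow> 'a::banach \<Rightarrow>\<^sub>L 'a"
    and G L :: "'a \<Rightarrow> ('a \<Rightarrow>\<^sub>L real) \<Rightarrow> real"
    and k :: nat
    and \<phi>\<^sub>0 :: 'a
  assumes "C0_semigroup T0"
    and "admissible_perturbation T0 G"
    and "1 \<le> k"
    and "Ck_sun_star T0 k G"
    and "equilibrium T0 G \<phi>\<^sub>0"
    and "has_sun_star_derivative T0 G L \<phi>\<^sub>0"
    and "perturbed_semigroup T0 L T"
  shows "\<forall>t\<^sub>0\<ge>0. \<forall>\<epsilon>>0. \<exists>\<delta>>0. \<forall>\<phi>. norm (\<phi> - \<phi>\<^sub>0) \<le> \<delta> \<longrightarrow>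
           (\<forall>t\<in>{0..t\<^sub>0}. t \<in> existence_interval T0 G \<phi> \<and>
              norm (semiflow T0 G t \<phi> - \<phi>\<^sub>0 - T t (\<phi> - \<phi>\<^sub>0)) \<le> \<epsilon> * norm (\<phi> - \<phi>\<^sub>0))"
proof (intro allI impI)
  fix b \<epsilon> :: real assume b: "0 \<le> b" and \<epsilon>: "0 < \<epsilon>"
  note C0 = assms(1)
  note lip = Ck_locally_lipschitz[OF assms(4,3)]
  have G: "continuous_map euclidean (sun_star_topology T0) G"
    using assms(2) by (simp add: admissible_perturbation_def)
  have T: "C0_semigroup T" and Teq: "\<And>x t. 0 \<le> t \<Longrightarrow>
      duhamel T0 (\<lambda>\<tau>. L (T \<tau> x)) 0 t = sun_embed T0 (T t x - T0 t x)"
    using assms(7) by (auto simp: perturbed_semigroup_iff[OF C0])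
  have eq: "duhamel T0 (\<lambda>\<tau>. G \<phi>\<^sub>0) 0 t = sun_embed T0 (\<phi>\<^sub>0 - T0 t \<phi>\<^sub>0)" if t: "0 \<le> t" for t
  proof -
    have sf: "semiflow T0 G \<tau> \<phi>\<^sub>0 = \<phi>\<^sub>0" if "0 \<le> \<tau>" for \<tau>
      using assms(5) that by (simp add: equilibrium_def)
    have "duhamel T0 (\<lambda>\<tau>. G \<phi>\<^sub>0) 0 t = duhamel T0 (\<lambda>\<tau>. G (semiflow T0 G \<tau> \<phi>\<^sub>0)) 0 t"
      by (intro duhamel_cong) (simp add: sf)
    also have "\<dots> = sun_embed T0 (\<phi>\<^sub>0 - T0 t \<phi>\<^sub>0)"
      using semiflow_eq_greatest_solution(1)[OF C0 lip G, of \<phi>\<^sub>0] assms(5) t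
      by (simp add: solution_on_iff[OF C0] equilibrium_def)
    finally show ?thesis .
  qed
  obtain \<delta>1 C where \<delta>1: "0 < \<delta>1" and C: "1 \<le> C"
    and near: "\<And>\<phi>. norm (\<phi> - \<phi>\<^sub>0) \<le> \<delta>1 \<Longrightarrow> \<exists>u. solution_on T0 G \<phi> {0..b} u \<and>
      (\<forall>t\<in>{0..b}. norm (u t - \<phi>\<^sub>0) \<le> C * norm (\<phi> - \<phi>\<^sub>0))"
    using solution_near_equilibrium[OF C0 lip assms(2) eq b] by metis
  obtain K where K: "0 \<le> K" and L: "\<And>h. L h \<in> sun_star T0" "\<And>x'. linear (\<lambda>h. L h x')"
    "\<And>h. sun_star_norm T0 (L h) \<le> K * norm h"
    using has_sun_star_derivative_bounded[OF assms(6)] by metis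
  obtain M where M: "1 \<le> M" "\<And>r. 0 \<le> r \<Longrightarrow> r \<le> max b 1 \<Longrightarrow> norm (T0 r) \<le> M"
    using C0_semigroup_bounded[OF C0] by metis
  define c where "c = M * M * K + 1"
  have c: "0 < c" using K by (simp add: c_def add_nonneg_pos)
  \<comment> \<open>\<open>D\<close> is the constant with which the final Gronwall estimate multiplies \<open>\<eta> * norm h\<close>; the summand \<open>1\<close> keeps it positive when \<open>b = 0\<close>.\<close>
  define D where "D = 2 * (M * M * (C * (b + 1))) * exp (2 * c * b)"
  have D: "0 < D" using M(1) C b by (simp add: D_def)
  define \<eta> where "\<eta> = \<epsilon> / D"
  have \<eta>: "0 < \<eta>" using \<epsilon> D by (simp add: \<eta>_def)
  obtain r where r: "0 < r" and rem: "\<And>y. norm (y - \<phi>\<^sub>0) \<le> r \<Longrightarrow>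
      sun_star_norm T0 (\<lambda>x'. G y x' - G \<phi>\<^sub>0 x' - L (y - \<phi>\<^sub>0) x') \<le> \<eta> * norm (y - \<phi>\<^sub>0)"
    using has_sun_star_derivative_remainder[OF assms(6) \<eta>] by metis
  have "t \<in> existence_interval T0 G \<phi> \<and>
      norm (semiflow T0 G t \<phi> - \<phi>\<^sub>0 - T t (\<phi> - \<phi>\<^sub>0)) \<le> \<epsilon> * norm (\<phi> - \<phi>\<^sub>0)"
    if \<phi>: "norm (\<phi> - \<phi>\<^sub>0) \<le> min \<delta>1 (r / C)" and t: "t \<in> {0..b}" for \<phi> t
  proof -
    define h where "h = \<phi> - \<phi>\<^sub>0"
    obtain u where u: "solution_on T0 G \<phi> {0..b} u"
      and close: "\<And>t. t \<in> {0..b} \<Longrightarrow> norm (u t - \<phi>\<^sub>0) \<le> C * norm h"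
      using near[of \<phi>] \<phi> by (auto simp: h_def)
    note u' = u[unfolded solution_on_iff[OF C0]]
    have uc: "continuous_on {0..b} u" using u' by blast
    have Tc: "continuous_on {0..b} (\<lambda>\<tau>. T \<tau> h)"
      using C0_semigroup_continuous_on[OF T] by (rule continuous_on_subset) auto
    have u_r: "norm (u t - \<phi>\<^sub>0) \<le> r" if "t \<in> {0..b}" for t
    proof -
      have "C * norm h \<le> r" using \<phi> C by (simp add: h_def field_simps)
      with close[OF that] show ?thesis by simp
    qed
    define w where "w t = u t - \<phi>\<^sub>0 - T t h" for t
    have wc: "continuous_on {0..b} w" unfolding w_def by (intro continuous_on_diff uc Tc continuous_on_const)
    have "norm (w t) \<le> 2 * (M * M * (\<eta> * (C * norm h) * b)) * exp (2 * c * t)"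
    proof (rule gronwall[OF _ _ c _ t])
      show "continuous_on {0..b} (\<lambda>\<tau>. norm (w \<tau>))" using wc by (intro continuous_intros)
      show "0 \<le> M * M * (\<eta> * (C * norm h) * b)" using M(1) \<eta> C b by simp
      fix s assume s: "s \<in> {0..b}"
      have cont: "continuous_on {0..s} u" "continuous_on {0..s} (\<lambda>\<tau>. T \<tau> h)" "continuous_on {0..s} w"
        using uc Tc wc s by (auto elim: continuous_on_subset)
      define f where "f \<tau> x' = G (u \<tau>) x' - G \<phi>\<^sub>0 x' - L (T \<tau> h) x'" for \<tau> x'
      note fc = continuous_map_compose_on[OF G cont(1)] continuous_map_compose_on[OF G continuous_on_const]
        sun_star_linear_continuous[OF L cont(2)]
      have "norm (w s) \<le> M * M * integral {0..s} (\<lambda>\<tau>. \<eta> * (C * norm h) + K * norm (w \<tau>))"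
      proof (rule mild_difference_bound[OF C0 M s])
        show "continuous_map (top_of_set {0..s}) (sun_star_topology T0) f"
          unfolding f_def by (intro sun_star_continuous_diff fc)
        show "continuous_on {0..s} (\<lambda>\<tau>. \<eta> * (C * norm h) + K * norm (w \<tau>))"
          using cont by (intro continuous_intros)
      next
        fix \<tau> assume "\<tau> \<in> {0..s}"
        then have \<tau>: "\<tau> \<in> {0..b}" using s by auto
        \<comment> \<open>\<open>?R\<close> is the Taylor remainder of \<open>G\<close>; the rest of the integrand is linear in \<open>w\<close>.\<close>
        let ?R = "\<lambda>x'. G (u \<tau>) x' - G \<phi>\<^sub>0 x' - L (u \<tau> - \<phi>\<^sub>0) x'"
        have Gs: "G y \<in> sun_star T0" for y using continuous_map_euclidean_sun_star[OF G] .
        have "L (u \<tau> - \<phi>\<^sub>0) x' = L (w \<tau>) x' + L (T \<tau> h) x'" for x'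
          using linear_add[OF L(2), of "w \<tau>" "T \<tau> h" x'] by (simp add: w_def)
        then have "f \<tau> = (\<lambda>x'. ?R x' + L (w \<tau>) x')" by (intro ext) (simp add: f_def)
        then have "sun_star_norm T0 (f \<tau>) \<le> sun_star_norm T0 ?R + sun_star_norm T0 (L (w \<tau>))"
          using sun_star_norm_triangle[of ?R T0 "L (w \<tau>)"] Gs L(1) by (simp add: sun_star_diff)
        moreover have "sun_star_norm T0 ?R \<le> \<eta> * (C * norm h)"
          using rem[OF u_r[OF \<tau>]] mult_left_mono[OF close[OF \<tau>], of \<eta>] \<eta> by linarith
        ultimately show "sun_star_norm T0 (f \<tau>) \<le> \<eta> * (C * norm h) + K * norm (w \<tau>)"
          using L(3)[of "w \<tau>"] by linarith
      next
        fix x' assume x': "x' \<in> sun T0"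
        have 1: "duhamel T0 (\<lambda>\<tau>. G (u \<tau>)) 0 s = sun_embed T0 (u s - T0 s \<phi>)" using u' s by blast
        have 2: "duhamel T0 (\<lambda>\<tau>. G \<phi>\<^sub>0) 0 s = sun_embed T0 (\<phi>\<^sub>0 - T0 s \<phi>\<^sub>0)" using eq s by simp
        have 3: "duhamel T0 (\<lambda>\<tau>. L (T \<tau> h)) 0 s = sun_embed T0 (T s h - T0 s h)" using Teq s by simp
        have "duhamel T0 f 0 s x' = duhamel T0 (\<lambda>\<tau>. G (u \<tau>)) 0 s x' - duhamel T0 (\<lambda>\<tau>. G \<phi>\<^sub>0) 0 s x'
            - duhamel T0 (\<lambda>\<tau>. L (T \<tau> h)) 0 s x'"
          unfolding f_def
          by (simp only: duhamel_diff[OF C0 x' sun_star_continuous_diff[OF fc(1,2)] fc(3)]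
              duhamel_diff[OF C0 x' fc(1,2)])
        then show "x' (w s) = duhamel T0 f 0 s x'"
          unfolding 1 2 3 using x' by (simp add: sun_embed_def w_def h_def blinfun.bilinear_simps)
      qed
      also have "integral {0..s} (\<lambda>\<tau>. \<eta> * (C * norm h) + K * norm (w \<tau>))
          = \<eta> * (C * norm h) * s + K * integral {0..s} (\<lambda>\<tau>. norm (w \<tau>))"
      proof -
        have "(\<lambda>\<tau>. K * norm (w \<tau>)) integrable_on {0..s}"
          using cont by (intro integrable_continuous_interval continuous_intros)
        then show ?thesis using s by (subst integral_add) auto
      qed
      also have "M * M * (\<eta> * (C * norm h) * s + K * integral {0..s} (\<lambda>\<tau>. norm (w \<tau>)))
          = M * M * (\<eta> * (C * norm h) * s) + M * M * K * integral {0..s} (\<lambda>\<tau>. norm (w \<tau>))"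
        by (simp add: algebra_simps)
      also have "\<dots> \<le> M * M * (\<eta> * (C * norm h) * b) + c * integral {0..s} (\<lambda>\<tau>. norm (w \<tau>))"
        unfolding c_def using cont s M(1) \<eta> C
        by (intro add_mono mult_left_mono mult_right_mono integral_nonneg
            integrable_continuous_interval continuous_intros) auto
      finally show "norm (w s) \<le> M * M * (\<eta> * (C * norm h) * b) + c * integral {0..s} (\<lambda>\<tau>. norm (w \<tau>))" .
    qed
    also have "\<dots> \<le> 2 * (M * M * (\<eta> * (C * norm h) * (b + 1))) * exp (2 * c * b)"
      using t c M(1) \<eta> C b by (intro mult_mono mult_left_mono) auto
    also have "\<dots> = \<eta> * D * norm h" by (simp add: D_def)
    also have "\<dots> = \<epsilon> * norm h" using D by (simp add: \<eta>_def)
    finally have "norm (w t) \<le> \<epsilon> * norm h" .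
    moreover have "t \<in> existence_interval T0 G \<phi> \<and> semiflow T0 G t \<phi> = u t"
      by (rule semiflow_eq_greatest_solution(2)[OF C0 lip G u t])
    ultimately show ?thesis by (simp add: w_def h_def)
  qed
  moreover have "0 < min \<delta>1 (r / C)" using \<delta>1 r C by simp
  ultimately show "\<exists>\<delta>>0. \<forall>\<phi>. norm (\<phi> - \<phi>\<^sub>0) \<le> \<delta> \<longrightarrow> (\<forall>t\<in>{0..b}. t \<in> existence_interval T0 G \<phi> \<and>
      norm (semiflow T0 G t \<phi> - \<phi>\<^sub>0 - T t (\<phi> - \<phi>\<^sub>0)) \<le> \<epsilon> * norm (\<phi> - \<phi>\<^sub>0))"
    by (intro exI[of _ "min \<delta>1 (r / C)"]) blast
qed

end
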